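(* Let $n\ge 1$ and let $X$ be a nonempty compact set in $\mathbb{R}^n$. For $R>0$ let $RX=\{Rx : x\in X\}$, and let $|\cdot|$ denote magnitude. Then $$|RX| \to 1 \quad\text{as } R\to 0$$ and $$R^{-n}|RX| \to \frac{\mathrm{Vol}(X)}{n!\,\omega_n}\quad\text{as } R\to\infty.$$
   Context: Subsets of $\mathbb{R}^n$ carry the Euclidean metric; $\mathrm{Vol}$ is Lebesgue measure on $\mathbb{R}^n$ and $\omega_n$ is the volume of the unit ball in $\mathbb{R}^n$. Magnitude: for a finite metric space $(\Xi,d)$, if $w:\Xi\to\mathbb{R}$ satisfies $\sum_{y\in \Xi}e^{-d(x,y)}w(y)=1$ for all $x\in \Xi$, then $|\Xi|:=\sum_{x\in \Xi}w(x)$ (independent of the choice of $w$; such $w$ exists for every finite subset of a Euclidean space). For a compact set $X\subseteq\mathbb{R}^n$, $|X|:=\sup\{|\Xi| : \Xi \text{ a finite subset of } X\}$. By a known theorem of Meckes, for compact $X\subseteq\mathbb{R}^n$ this equals $$|X|=\frac{1}{n!\,\omega_n}\inf\left\{\|f\|^2_{H^{(n+1)/2}(\mathbb{R}^n)} : f\in H^{(n+1)/2}(\mathbb{R}^n),\ f\equiv 1\text{ on }X\right\},$$ where $\|f\|^2_{H^{m}(\mathbb{R}^n)}=\|(I-\Delta)^{m/2}f\|^2_{L^2(\mathbb{R}^n)}=\int_{\mathbb{R}^n}(1+4\pi^2|\xi|^2)^{m}|\widehat f(\xi)|^2\,d\xi$ and $\widehat f(\xi)=\int f(x)e^{-2\pi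 i x\cdot\xi}dx$. *)

theory Defs
  imports "HOL-Analysis.Analysis"
begin

definition weighting :: "'a::metric_space set \<Rightarrow> ('a \<Rightarrow> real) \<Rightarrow> bool" where
  "weighting S w \<longleftrightarrow> (\<forall>x\<in>S. (\<Sum>y\<in>S. exp (- dist x y) * w y) = 1)"

(* Meaningful only if S is finite and has a weighting; the latter always holds for finite
   subsets of Euclidean spaces. Independence of the weighting is finite_magnitude_eq. *)
definition finite_magnitude :: "'a::metric_space set \<Rightarrow> real" where
  "finite_magnitude S = (THE m. \<exists>w. weighting S w \<and> m = (\<Sum>x\<in>S. w x))"

lemma weighting_sum_unique:
  assumes "weighting S v" "weighting S w"
  shows "(\<Sum>x\<in>S. v x) = (\<Sum>x\<in>S. w x)"
proof -
  have "(\<Sum>x\<in>S. v x) = (\<Sum>x\<in>S. v x * (\<Sum>y\<in>S. exp (- dist x y) * w y))"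
    using assms(2) by (intro sum.cong) (auto simp: weighting_def)
  also have "\<dots> = (\<Sum>x\<in>S. \<Sum>y\<in>S. v x * (exp (- dist x y) * w y))"
    by (simp add: sum_distrib_left)
  also have "\<dots> = (\<Sum>y\<in>S. \<Sum>x\<in>S. v x * (exp (- dist x y) * w y))"
    by (rule sum.swap)
  also have "\<dots> = (\<Sum>y\<in>S. w y * (\<Sum>x\<in>S. exp (- dist y x) * v x))"
    by (simp add: sum_distrib_left dist_commute mult_ac)
  also have "\<dots> = (\<Sum>y\<in>S. w y)"
    using assms(1) by (intro sum.cong) (auto simp: weighting_def)
  finally show ?thesis .
qed

lemma finite_magnitude_eq:
  assumes "weighting S w"
  shows "finite_magnitude S = (\<Sum>x\<in>S. w x)"
  unfolding finite_magnitude_def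
  using assms weighting_sum_unique by (intro the_equality) blast+

(* The supremum is taken in the extended reals, so that no boundedness is presupposed. *)
definition magnitude :: "'a::euclidean_space set \<Rightarrow> ereal" where
  "magnitude X = (SUP S\<in>{S. finite S \<and> S \<subseteq> X}. ereal (finite_magnitude S))"

end

theory Submission
  imports Defs "HOL-Probability.Distributions" "HOL-Real_Asymp.Real_Asymp"
begin

text \<open>
  Subordination to Gaussians gives a measure \<open>N\<close> on radii with
  \<open>exp (- dist x y) = \<integral> vol (ball x r \<inter> ball y r) N(dr)\<close>, so points are represented in
  \<open>L\<^sup>2(N \<otimes> vol)\<close> by the indicators \<open>\<phi>\<^sub>x\<close> of \<open>{(r, z). dist x z < r}\<close>. If \<open>\<langle>F, \<phi>\<^sub>x\<rangle> = 1\<close> for all \<open>x \<in> X\<close>,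
  then \<open>|X| \<le> \<parallel>F\<parallel>\<^sup>2\<close>. Functions \<open>F(r, z) = a(r)\<close> on the \<open>r\<close>-neighbourhoods of \<open>X\<close>, zero outside,
  satisfy this constraint exactly once \<open>a\<close> is normalised. Taking \<open>a\<close> constant above a cut-off
  gives the limit at \<open>0\<close>; taking \<open>a(r) = r\<^sup>n / n!\<close>, which is proportional to the volume of the ball,
  gives the upper bound at infinity by dominated convergence. The matching lower bound holds for
  every \<open>X\<close>: use (approximations of) the uniform density \<open>1 / (n! \<omega>\<^sub>n)\<close> on \<open>X\<close> as weights.
\<close>

text \<open>The bound by |F|^2 is a projection argument: for a weighting w of a finite S in X, the
  sum g of the w(x) phi_x has <g, g> = <F, g> = |S|, and |F - g|^2 >= 0 gives |S| <= |F|^2. The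
  constraint on F is exact because the r-ball about a point x of X lies inside the r-neighbourhood
  X_r: phi_x sees only a(r) times the volume b(r) of an r-ball, whatever x is. It remains to make
  the integral of a(r)^2 vol(X_r) against N small while that of a(r) b(r) is 1. For tiny sets
  vol(X_r) is close to b(r), and since b integrates to 1, Cauchy-Schwarz favours constant a with
  value 1. For n >= 2, however, N has infinite mass near r = 0, where b(r) is a poor substitute for
  vol(X_r); hence the cut-off. For huge sets vol((RX)_r) is close to R^n vol(X), which favours a
  proportional to b. The factor comes from integrating the kernel formula over x: the integral of
  b^2 against N equals that of exp(-|x|) over R^n, namely n! \<omega>_n.\<close>

section \<open>Weightings and positive definiteness\<close>

text \<open>One column is eliminated at a time, with \<open>b\<close> arbitrary in the induction. If
  \<open>v\<close> shows that the columns in \<open>T\<close> miss \<open>b\<close>, but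
  \<open>v\<close> does not annihilate the new column \<open>t\<close>, the induction hypothesis is
  used again for \<open>b\<close> minus the multiple \<open>l\<close> of column \<open>t\<close>
  that makes the difference orthogonal to \<open>v\<close>.\<close>

lemma fredholm_alternative_finite:
  fixes G :: "'a \<Rightarrow> 'b \<Rightarrow> real"
  assumes "finite T" "finite S"
  shows "(\<exists>w. \<forall>x\<in>S. (\<Sum>y\<in>T. G x y * w y) = b x) \<or>
    (\<exists>v. (\<forall>y\<in>T. (\<Sum>x\<in>S. v x * G x y) = 0) \<and> (\<Sum>x\<in>S. v x * b x) \<noteq> 0)"
  using assms(1)
proof (induction T arbitrary: b rule: finite_induct)
  case empty
  show ?case
  proof (cases "\<forall>x\<in>S. b x = 0")
    case False
    then obtain x0 where "x0 \<in> S" "b x0 \<noteq> 0" by blast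
    then have "(\<Sum>x\<in>S. (if x = x0 then 1 else 0) * b x) \<noteq> 0"
      using assms(2) by (simp add: if_distrib[where f="\<lambda>z. z * _"] cong: if_cong)
    then have "\<exists>v. (\<Sum>x\<in>S. v x * b x) \<noteq> 0" by (intro exI)
    then show ?thesis by simp
  qed simp
next
  case (insert t T)
  have solve: "\<exists>w. \<forall>x\<in>S. (\<Sum>y\<in>insert t T. G x y * w y) = c x"
    if "\<forall>x\<in>S. (\<Sum>y\<in>T. G x y * w y) = c x - l * G x t" for c w l
  proof -
    have "\<forall>x\<in>S. (\<Sum>y\<in>insert t T. G x y * (w(t := l)) y) = c x"
    proof
      fix x assume "x \<in> S"
      have "(\<Sum>y\<in>T. G x y * (w(t := l)) y) = (\<Sum>y\<in>T. G x y * w y)"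
        using insert.hyps by (intro sum.cong) auto
      with that \<open>x \<in> S\<close> show "(\<Sum>y\<in>insert t T. G x y * (w(t := l)) y) = c x"
        using insert.hyps by simp
    qed
    then show ?thesis by blast
  qed
  from insert.IH[of b] show ?case
  proof (elim disjE exE conjE)
    fix w assume "\<forall>x\<in>S. (\<Sum>y\<in>T. G x y * w y) = b x"
    then show ?thesis using solve[of w b 0] by simp
  next
    fix v assume v: "\<forall>y\<in>T. (\<Sum>x\<in>S. v x * G x y) = 0" "(\<Sum>x\<in>S. v x * b x) \<noteq> 0"
    define g where "g = (\<Sum>x\<in>S. v x * G x t)"
    define l where "l = (\<Sum>x\<in>S. v x * b x) / g"
    show ?thesis
    proof (cases "g = 0")
      case True
      with v have "\<forall>y\<in>insert t T. (\<Sum>x\<in>S. v x * G x y) = 0" by (simp add: g_def)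
      with v show ?thesis by blast
    next
      case False
      from insert.IH[of "\<lambda>x. b x - l * G x t"] show ?thesis
      proof (elim disjE exE conjE)
        fix w assume "\<forall>x\<in>S. (\<Sum>y\<in>T. G x y * w y) = b x - l * G x t"
        then show ?thesis using solve by blast
      next
        fix u assume u: "\<forall>y\<in>T. (\<Sum>x\<in>S. u x * G x y) = 0"
          "(\<Sum>x\<in>S. u x * (b x - l * G x t)) \<noteq> 0"
        define h where "h = (\<Sum>x\<in>S. u x * G x t)"
        \<comment> \<open>\<open>q\<close> corrects \<open>u\<close> along \<open>v\<close> so as to
          annihilate column \<open>t\<close>. By the choice of \<open>l\<close> it pairs with
          \<open>b\<close> exactly as \<open>u\<close> pairs with the reduced right-hand
          side.\<close>
        define q where "q x = u x - h / g * v x" for x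
        have q: "(\<Sum>x\<in>S. q x * f x) = (\<Sum>x\<in>S. u x * f x) - h / g * (\<Sum>x\<in>S. v x * f x)" for f
          unfolding q_def by (simp add: algebra_simps sum_subtractf sum_distrib_left)
        have "(\<Sum>x\<in>S. u x * (b x - l * G x t)) = (\<Sum>x\<in>S. u x * b x) - l * h"
          unfolding h_def by (simp add: algebra_simps sum_subtractf sum_distrib_left)
        then have "(\<Sum>x\<in>S. q x * b x) \<noteq> 0"
          using u(2) unfolding q l_def by (simp add: field_simps)
        moreover have "\<forall>y\<in>insert t T. (\<Sum>x\<in>S. q x * G x y) = 0"
          using u v False unfolding q by (auto simp: g_def[symmetric] h_def[symmetric])
        ultimately show ?thesis by blast
      qed
    qed
  qed
qed

text \<open>The Hilbert space argument needs only sets with prescribed overlaps, so it is carried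
  out for any metric space; balls enter when the locale is interpreted.\<close>

locale exp_kernel_representation =
  fixes M :: "'b measure" and A :: "'a::metric_space \<Rightarrow> 'b set"
  assumes sets_A [measurable]: "A x \<in> sets M"
    and emeasure_A_Int: "emeasure M (A x \<inter> A y) = ennreal (exp (- dist x y))"
begin

lemma emeasure_A: "emeasure M (A x) = 1"
  using emeasure_A_Int[of x x] by simp

lemma integrable_A_Int: "integrable M (\<lambda>z. indicator (A x) z * indicator (A y) z :: real)"
proof -
  have "integrable M (indicator (A x \<inter> A y) :: _ \<Rightarrow> real)"
    by (rule integrable_real_indicator) (auto simp: emeasure_A_Int)
  then show ?thesis by (simp add: indicator_inter_arith[abs_def])
qed

lemma integral_A_Int: "(\<integral>z. indicator (A x) z * indicator (A y) z \<partial>M) = exp (- dist x y)"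
proof -
  have "(\<integral>z. indicator (A x) z * indicator (A y) z \<partial>M) = measure M (A x \<inter> A y)"
    using sets.sets_into_space[OF sets_A[of x]]
    by (subst indicator_inter_arith[symmetric]) (simp add: Int_absorb2 le_infI1)
  then show ?thesis by (simp add: measure_def emeasure_A_Int)
qed

lemma
  assumes "finite S"
  shows integrable_form: "integrable M (\<lambda>z. (\<Sum>x\<in>S. u x * indicator (A x) z) * (\<Sum>y\<in>S. v y * indicator (A y) z :: real))"
    and integral_form: "(\<integral>z. (\<Sum>x\<in>S. u x * indicator (A x) z) * (\<Sum>y\<in>S. v y * indicator (A y) z) \<partial>M)
      = (\<Sum>x\<in>S. \<Sum>y\<in>S. u x * v y * exp (- dist x y))"
proof -
  have eq: "(\<Sum>x\<in>S. u x * indicator (A x) z) * (\<Sum>y\<in>S. v y * indicator (A y) z) =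
    (\<Sum>x\<in>S. \<Sum>y\<in>S. (u x * v y) * (indicator (A x) z * indicator (A y) z))" for z
    by (simp add: sum_product ac_simps)
  show "integrable M (\<lambda>z. (\<Sum>x\<in>S. u x * indicator (A x) z) * (\<Sum>y\<in>S. v y * indicator (A y) z :: real))"
    unfolding eq by (intro Bochner_Integration.integrable_sum integrable_mult_right integrable_A_Int)
  show "(\<integral>z. (\<Sum>x\<in>S. u x * indicator (A x) z) * (\<Sum>y\<in>S. v y * indicator (A y) z) \<partial>M)
      = (\<Sum>x\<in>S. \<Sum>y\<in>S. u x * v y * exp (- dist x y))"
    unfolding eq
    by (subst Bochner_Integration.integral_sum
      | intro sum.cong Bochner_Integration.integrable_sum integrable_mult_right integrable_A_Int refl
      | simp add: integral_A_Int)+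
qed

lemma integral_test_function:
  fixes F :: "'b \<Rightarrow> real"
  assumes "finite S"
    and "\<And>x. x \<in> S \<Longrightarrow> has_bochner_integral M (\<lambda>z. F z * indicator (A x) z) 1"
  shows "has_bochner_integral M (\<lambda>z. F z * (\<Sum>x\<in>S. u x * indicator (A x) z)) (\<Sum>x\<in>S. u x)"
proof -
  have "has_bochner_integral M (\<lambda>z. \<Sum>x\<in>S. u x * (F z * indicator (A x) z)) (\<Sum>x\<in>S. u x * 1)"
    by (intro has_bochner_integral_sum has_bochner_integral_mult_right assms)
  then show ?thesis by (simp add: sum_distrib_left mult_ac)
qed

text \<open>A vector in the kernel of the matrix has vanishing feature function, and pairing the latter with
  the indicator of the union of the features returns the sum of the entries; so the Fredholm alternative applies
  without strict positive definiteness.\<close>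
lemma weighting_exists:
  fixes S :: "'a set"
  assumes S: "finite S"
  shows "\<exists>w. weighting S w"
proof (rule ccontr)
  assume neg: "\<nexists>w. weighting S w"
  from fredholm_alternative_finite[OF S S, of "\<lambda>x y. exp (- dist x y)" "\<lambda>_. 1"] neg
  obtain v where v: "\<And>y. y \<in> S \<Longrightarrow> (\<Sum>x\<in>S. v x * exp (- dist x y)) = 0"
    and v1: "(\<Sum>x\<in>S. v x) \<noteq> 0"
    unfolding weighting_def by auto
  define g where "g z = (\<Sum>x\<in>S. v x * indicator (A x) z :: real)" for z
  define F :: "'b \<Rightarrow> real" where "F = indicator (\<Union>x\<in>S. A x)"
  have "(\<Sum>x\<in>S. \<Sum>y\<in>S. v x * v y * exp (- dist x y)) =
      (\<Sum>y\<in>S. v y * (\<Sum>x\<in>S. v x * exp (- dist x y)))"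
    by (subst sum.swap) (simp add: sum_distrib_left mult_ac)
  also have "\<dots> = 0" using v by simp
  finally have "(\<integral>z. g z * g z \<partial>M) = 0" unfolding g_def integral_form[OF S] .
  moreover have "integrable M (\<lambda>z. g z * g z)" unfolding g_def by (rule integrable_form[OF S])
  ultimately have ae: "AE z in M. g z = 0"
    by (subst (asm) integral_nonneg_eq_0_iff_AE) auto
  have "has_bochner_integral M (\<lambda>z. F z * g z) (\<Sum>x\<in>S. v x)"
    unfolding g_def
  proof (rule integral_test_function[OF S])
    fix x assume "x \<in> S"
    then have "(\<lambda>z. F z * indicator (A x) z) = indicator (A x)"
      by (auto simp: F_def fun_eq_iff split: split_indicator)
    moreover have "has_bochner_integral M (indicator (A x)) (measure M (A x))"
      by (rule has_bochner_integral_real_indicator) (simp_all add: emeasure_A)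
    ultimately show "has_bochner_integral M (\<lambda>z. F z * indicator (A x) z) 1"
      by (simp add: measure_def emeasure_A)
  qed
  moreover have "AE z in M. F z * g z = 0" using ae by eventually_elim simp
  ultimately have "(\<Sum>x\<in>S. v x) = 0"
    by (metis has_bochner_integral_integral_eq integral_eq_zero_AE)
  with v1 show False by simp
qed

text \<open>Against a weighting every \<open>u\<close> pairs as with the constant 1. For
  \<open>u = w\<close> this identifies the squared norm of the feature function of \<open>w\<close>
  with the magnitude.\<close>

lemma weighting_pairing:
  fixes S :: "'a set"
  assumes "weighting S w"
  shows "(\<Sum>x\<in>S. \<Sum>y\<in>S. u x * w y * exp (- dist x y)) = (\<Sum>x\<in>S. u x)"
proof (rule sum.cong[OF refl])
  fix x assume "x \<in> S"
  have "(\<Sum>y\<in>S. u x * w y * exp (- dist x y)) = u x * (\<Sum>y\<in>S. exp (- dist x y) * w y)"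
    by (simp add: sum_distrib_left mult_ac)
  with assms \<open>x \<in> S\<close> show "(\<Sum>y\<in>S. u x * w y * exp (- dist x y)) = u x"
    by (simp add: weighting_def)
qed

text \<open>A concave quadratic in \<open>u\<close> whose maximum is attained at a weighting
  \<open>w\<close>: the gap is the squared norm of the feature function of \<open>u - w\<close>. Any
  trial weights therefore give a lower bound.\<close>

lemma finite_magnitude_ge:
  fixes S :: "'a set"
  assumes S: "finite S"
  shows "2 * (\<Sum>x\<in>S. u x) - (\<Sum>x\<in>S. \<Sum>y\<in>S. u x * u y * exp (- dist x y)) \<le> finite_magnitude S"
proof -
  obtain w where w: "weighting S w" using weighting_exists[OF S] by blast
  define g where "g v z = (\<Sum>x\<in>S. v x * indicator (A x) z :: real)" for v z
  have "0 \<le> (\<integral>z. g (\<lambda>x. u x - w x) z * g (\<lambda>x. u x - w x) z \<partial>M)"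
    by (intro integral_nonneg_AE) simp
  also have "\<dots> = (\<integral>z. g u z * g u z - 2 * (g u z * g w z) + g w z * g w z \<partial>M)"
    by (intro Bochner_Integration.integral_cong refl) (simp add: g_def algebra_simps sum_subtractf)
  also have "\<dots> = (\<integral>z. g u z * g u z \<partial>M) - 2 * (\<integral>z. g u z * g w z \<partial>M) + (\<integral>z. g w z * g w z \<partial>M)"
    using integrable_form[OF S, folded g_def] by simp
  also have "\<dots> = (\<Sum>x\<in>S. \<Sum>y\<in>S. u x * u y * exp (- dist x y)) - 2 * (\<Sum>x\<in>S. u x) + (\<Sum>x\<in>S. w x)"
    unfolding g_def integral_form[OF S] weighting_pairing[OF w] ..
  finally show ?thesis using finite_magnitude_eq[OF w] by simp
qed

text \<open>\<open>g\<close> is the orthogonal projection of \<open>F\<close> onto the span of the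
  features of \<open>S\<close>, since both pair to 1 with each of them; the gap is the squared
  distance from \<open>F\<close> to \<open>g\<close>.\<close>

lemma finite_magnitude_le:
  fixes F :: "'b \<Rightarrow> real"
  assumes S: "finite S"
    and F: "\<And>x. x \<in> S \<Longrightarrow> has_bochner_integral M (\<lambda>z. F z * indicator (A x) z) 1"
    and F2: "integrable M (\<lambda>z. F z * F z)"
  shows "finite_magnitude S \<le> (\<integral>z. F z * F z \<partial>M)"
proof -
  obtain w where w: "weighting S w" using weighting_exists[OF S] by blast
  define g where "g z = (\<Sum>x\<in>S. w x * indicator (A x) z :: real)" for z
  have Fg: "has_bochner_integral M (\<lambda>z. F z * g z) (\<Sum>x\<in>S. w x)"
    unfolding g_def by (rule integral_test_function[OF S F])
  have gg: "integrable M (\<lambda>z. g z * g z)" "(\<integral>z. g z * g z \<partial>M) = (\<Sum>x\<in>S. w x)"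
    unfolding g_def by (rule integrable_form[OF S], simp only: integral_form[OF S] weighting_pairing[OF w])
  have "0 \<le> (\<integral>z. (F z - g z) * (F z - g z) \<partial>M)"
    by (intro integral_nonneg_AE) simp
  also have "\<dots> = (\<integral>z. F z * F z - 2 * (F z * g z) + g z * g z \<partial>M)"
    by (intro Bochner_Integration.integral_cong refl) (simp add: algebra_simps)
  also have "\<dots> = (\<integral>z. F z * F z \<partial>M) - 2 * (\<integral>z. F z * g z \<partial>M) + (\<integral>z. g z * g z \<partial>M)"
    using F2 gg(1) integrable.intros[OF Fg]
    by simp
  also have "\<dots> = (\<integral>z. F z * F z \<partial>M) - (\<Sum>x\<in>S. w x)"
    using Fg gg by (simp add: has_bochner_integral_integral_eq)
  finally show ?thesis using finite_magnitude_eq[OF w] by simp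
qed

lemma finite_magnitude_le_nn_integral:
  fixes F :: "'b \<Rightarrow> real"
  assumes [measurable]: "F \<in> borel_measurable M" and nonneg: "\<And>z. 0 \<le> F z"
    and F: "\<And>x. x \<in> X \<Longrightarrow> (\<integral>\<^sup>+z. ennreal (F z) * indicator (A x) z \<partial>M) = 1"
    and S: "finite S" "S \<subseteq> X"
  shows "ereal (finite_magnitude S) \<le> enn2ereal (\<integral>\<^sup>+z. ennreal ((F z)\<^sup>2) \<partial>M)"
proof (cases "(\<integral>\<^sup>+z. ennreal ((F z)\<^sup>2) \<partial>M)")
  case (real r)
  have h: "has_bochner_integral M (\<lambda>z. F z * F z) r"
    using real nonneg by (intro has_bochner_integral_nn_integral) (auto simp: power2_eq_square)
  have "finite_magnitude S \<le> (\<integral>z. F z * F z \<partial>M)"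
  proof (rule finite_magnitude_le[OF S(1)])
    fix x assume "x \<in> S"
    have "(\<integral>\<^sup>+z. ennreal (F z * indicator (A x) z) \<partial>M) = (\<integral>\<^sup>+z. ennreal (F z) * indicator (A x) z \<partial>M)"
      by (intro nn_integral_cong) (simp split: split_indicator)
    then have "(\<integral>\<^sup>+z. ennreal (F z * indicator (A x) z) \<partial>M) = ennreal 1"
      using F S \<open>x \<in> S\<close> by auto
    then show "has_bochner_integral M (\<lambda>z. F z * indicator (A x) z) 1"
      using nonneg by (intro has_bochner_integral_nn_integral) auto
  qed (rule integrable.intros[OF h])
  also have "\<dots> = r" using h by (rule has_bochner_integral_integral_eq)
  finally show ?thesis using real by (simp add: enn2ereal_ennreal)
qed simp

end

section \<open>Gaussian integrals and subordination\<close>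

text \<open>\<open>g\<close> is the error function scaled by sqrt pi / 2; only these four properties
  enter below.\<close>

lemma gaussian_primitive:
  obtains g :: "real \<Rightarrow> real" where
    "\<And>y. (g has_real_derivative exp (- y\<^sup>2)) (at y)"
    "\<And>y. g (- y) = - g y"
    "(g \<longlongrightarrow> sqrt pi / 2) at_top"
    "(g \<longlongrightarrow> - (sqrt pi / 2)) at_bot"
proof -
  have "\<exists>F. \<forall>x::real. -\<infinity> < ereal x \<longrightarrow> ereal x < \<infinity> \<longrightarrow> (F has_vector_derivative exp (- x\<^sup>2)) (at x)"
    by (rule einterval_antiderivative) auto
  then obtain F where F: "\<And>x::real. (F has_real_derivative exp (- x\<^sup>2)) (at x)"
    by (auto simp: has_real_derivative_iff_has_vector_derivative)
  define g where "g x = F x - F 0" for x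
  have g: "(g has_real_derivative exp (- x\<^sup>2)) (at x)" for x
    unfolding g_def by (auto intro!: derivative_eq_intros F)
  have "((\<lambda>x. g x + g (- x)) has_real_derivative 0) (at x)" for x
    by (auto intro!: derivative_eq_intros DERIV_chain2[OF g])
  then have "g x + g (- x) = g 0 + g (- 0)" for x
    by (rule DERIV_isconst_all[of "\<lambda>x. g x + g (- x)", OF allI])
  then have odd: "g (- x) = - g x" for x
    by (simp add: g_def algebra_simps)
  have "((\<lambda>y. \<integral>x. indicator {..y} x *\<^sub>R (indicator {0..} x *\<^sub>R exp (- x\<^sup>2)) \<partial>lborel) \<longlongrightarrow> sqrt pi / 2) at_top"
    using tendsto_integral_at_top[OF sets_lborel integrable.intros[OF gaussian_moment_0]]
    unfolding has_bochner_integral_integral_eq[OF gaussian_moment_0] .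
  moreover have "eventually (\<lambda>y. (\<integral>x. indicator {..y} x *\<^sub>R (indicator {0..} x *\<^sub>R exp (- x\<^sup>2)) \<partial>lborel) = g y) at_top"
    using eventually_ge_at_top[of 0]
  proof eventually_elim
    case (elim y)
    have "(\<integral>x. indicator {..y} x *\<^sub>R (indicator {0..} x *\<^sub>R exp (- x\<^sup>2)) \<partial>lborel) = 
      (\<integral>x. exp (- x\<^sup>2) * indicator {0..y} x \<partial>lborel)"
      by (intro Bochner_Integration.integral_cong) (auto split: split_indicator)
    also have "\<dots> = g y - g 0"
      using elim by (intro integral_FTC_Icc_real g) (auto)
    finally show ?case by (simp add: g_def)
  qed
  ultimately have top: "(g \<longlongrightarrow> sqrt pi / 2) at_top"
    by (rule Lim_transform_eventually)
  have "((\<lambda>x. - g (- x)) \<longlongrightarrow> - (sqrt pi / 2)) at_bot"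
    by (intro tendsto_minus filterlim_compose[OF top] filterlim_uminus_at_top_at_bot)
  then have bot: "(g \<longlongrightarrow> - (sqrt pi / 2)) at_bot"
    by (simp add: odd)
  show thesis using that[OF g odd top bot] .
qed

text \<open>The value is sqrt pi times the complementary error function at \<open>c\<close>. The
  second claim keeps \<open>ennreal\<close> from truncating it.\<close>

lemma nn_integral_gaussian_abs_shift:
  assumes g: "\<And>y. (g has_real_derivative exp (- y\<^sup>2)) (at y)" "(g \<longlongrightarrow> sqrt pi / 2) at_top"
  shows "(\<integral>\<^sup>+t. ennreal (exp (- (\<bar>t\<bar> + c)\<^sup>2)) \<partial>lborel) = ennreal (sqrt pi - 2 * g c)"
    and "g c \<le> sqrt pi / 2"
proof -
  have nonneg: "g x \<le> sqrt pi / 2" for x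
  proof (rule tendsto_lowerbound[OF g(2)])
    show "\<forall>\<^sub>F y in at_top. g x \<le> g y"
      using eventually_ge_at_top[of x]
      by eventually_elim (rule DERIV_nonneg_imp_nondecreasing, auto intro!: exI g)
  qed simp
  have half: "(\<integral>\<^sup>+t. ennreal (exp (- (t + c)\<^sup>2)) * indicator {0..} t \<partial>lborel) = ennreal (sqrt pi / 2 - g c)"
  proof (subst nn_integral_FTC_atLeast)
    show "((\<lambda>t. g (t + c)) has_real_derivative exp (- (t + c)\<^sup>2)) (at t)" for t
      by (rule DERIV_chain2[OF g(1), THEN DERIV_cong]) (auto intro!: derivative_eq_intros)
    show "((\<lambda>t. g (t + c)) \<longlongrightarrow> sqrt pi / 2) at_top"
      by (rule filterlim_compose[OF g(2)]) real_asymp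
  qed auto
  have "(\<integral>\<^sup>+t. ennreal (exp (- (\<bar>t\<bar> + c)\<^sup>2)) \<partial>lborel)
      = (\<integral>\<^sup>+t. ennreal (exp (- (t + c)\<^sup>2)) * indicator {0..} t + ennreal (exp (- (- t + c)\<^sup>2)) * indicator {..<0} t \<partial>lborel)"
    by (intro nn_integral_cong) (auto split: split_indicator)
  also have "\<dots> = ennreal (sqrt pi / 2 - g c) + (\<integral>\<^sup>+t. ennreal (exp (- (- t + c)\<^sup>2)) * indicator {..<0} t \<partial>lborel)"
    by (subst nn_integral_add) (auto simp: half)
  also have "(\<integral>\<^sup>+t. ennreal (exp (- (- t + c)\<^sup>2)) * indicator {..<0} t \<partial>lborel) =
      (\<integral>\<^sup>+t. ennreal (exp (- (t + c)\<^sup>2)) * indicator {0<..} t \<partial>lborel)"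
    by (subst nn_integral_real_affine[of _ "-1" 0]) (auto intro!: nn_integral_cong split: split_indicator)
  also have "\<dots> = (\<integral>\<^sup>+t. ennreal (exp (- (t + c)\<^sup>2)) * indicator {0..} t \<partial>lborel)"
    by (intro nn_integral_cong_AE AE_I[where N="{0}"]) (auto split: split_indicator)
  also have "ennreal (sqrt pi / 2 - g c) + \<dots> = ennreal (sqrt pi - 2 * g c)"
    unfolding half using nonneg[of c] by (subst ennreal_plus[symmetric]) auto
  finally show "(\<integral>\<^sup>+t. ennreal (exp (- (\<bar>t\<bar> + c)\<^sup>2)) \<partial>lborel) = ennreal (sqrt pi - 2 * g c)" .
  show "g c \<le> sqrt pi / 2" by (rule nonneg)
qed

lemma nn_integral_gaussian: "(\<integral>\<^sup>+t. ennreal (exp (- t\<^sup>2)) \<partial>lborel) = ennreal (sqrt pi)"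
proof -
  obtain g where g: "\<And>y. (g has_real_derivative exp (- y\<^sup>2)) (at y)" "\<And>y. g (- y) = - g y"
    "(g \<longlongrightarrow> sqrt pi / 2) at_top" by (rule gaussian_primitive) blast
  have "g 0 = 0" using g(2)[of 0] by simp
  with nn_integral_gaussian_abs_shift[of g 0] g show ?thesis by simp
qed

text \<open>The tail of a Rayleigh distribution is Gaussian in the threshold; this is what the
  weight in \<open>s\<close> of \<open>radius_density\<close> is chosen for.\<close>

lemma nn_integral_two_exp_square:
  "(\<integral>\<^sup>+s. ennreal (2 * s * exp (- s\<^sup>2)) * indicator {a..} s \<partial>lborel) = ennreal (exp (- a\<^sup>2))"
  if "0 \<le> a"
proof -
  have "((\<lambda>s::real. - exp (- s\<^sup>2)) \<longlongrightarrow> - 0) at_top"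
    by (intro tendsto_minus filterlim_compose[OF exp_at_bot]
        filterlim_compose[OF filterlim_uminus_at_bot_at_top] filterlim_pow_at_top filterlim_ident) auto
  then show ?thesis
    using that by (subst nn_integral_FTC_atLeast[where F="\<lambda>s. - exp (- s\<^sup>2)" and T=0])
      (auto intro!: derivative_eq_intros)
qed

lemma nn_integral_exp_subordination:
  assumes c: "0 \<le> c"
  shows "(\<integral>\<^sup>+v. ennreal (2 * v * exp (- v\<^sup>2) / sqrt pi) * (\<integral>\<^sup>+t. ennreal (exp (- (\<bar>t\<bar> + c / v)\<^sup>2)) \<partial>lborel)
    * indicator {0<..} v \<partial>lborel) = ennreal (exp (- (2 * c)))"
\<comment> \<open>For \<open>c = 0\<close> the quotient \<open>c / v\<close> does not tend to
  infinity as \<open>v\<close> tends to 0, so the boundary limits used in the other case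
  fail.\<close>
proof (cases "c = 0")
  case True
  have "(\<integral>\<^sup>+v. ennreal (2 * v * exp (- v\<^sup>2) / sqrt pi) * ennreal (sqrt pi) * indicator {0<..} v \<partial>lborel)
     = (\<integral>\<^sup>+s. ennreal (2 * s * exp (- s\<^sup>2)) * indicator {0..} s \<partial>lborel)"
    by (intro nn_integral_cong_AE AE_I[where N="{0}"]) (auto simp: ennreal_mult'[symmetric] split: split_indicator)
  then show ?thesis using True nn_integral_two_exp_square[of 0]
    by (simp add: nn_integral_gaussian)
next
  case False
  with c have c: "0 < c" by simp
  obtain g where g: "\<And>y. (g has_real_derivative exp (- y\<^sup>2)) (at y)" "\<And>y. g (- y) = - g y"
    "(g \<longlongrightarrow> sqrt pi / 2) at_top" "(g \<longlongrightarrow> - (sqrt pi / 2)) at_bot" by (rule gaussian_primitive) blast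
  define f where "f v = 2 * v * exp (- v\<^sup>2) / sqrt pi * (sqrt pi - 2 * g (c / v))" for v
  \<comment> \<open>The first term comes from integrating \<open>f\<close> by parts, which leaves 2
    c / v^2 times exp(- v^2 - (c / v)^2). The other two terms are a primitive of that remainder:
    \<open>e1\<close> and \<open>e2\<close> complete the square in both ways, and the derivatives 1
    + c / v^2 and 1 - c / v^2 of \<open>v - c / v\<close> and \<open>v + c / v\<close> differ by 2 c
    / v^2.\<close>
  define F where "F v = (- (2 * exp (- v\<^sup>2) * (sqrt pi / 2 - g (c / v)))
      + exp (- (2 * c)) * g (v - c / v) - exp (2 * c) * g (v + c / v)) / sqrt pi" for v
  have gle: "g x \<le> sqrt pi / 2" for x by (rule nn_integral_gaussian_abs_shift(2)[OF g(1,3)])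
  have gcont: "isCont g x" for x using g(1) by (rule DERIV_isCont)
  have F: "(F has_real_derivative f v) (at v)" if "0 < v" for v
  proof -
    have e1: "exp (- (2 * c)) * exp (- (v - c / v)\<^sup>2) = exp (- v\<^sup>2) * exp (- (c / v)\<^sup>2)"
      using that by (simp add: exp_add[symmetric] power2_diff)
    have e2: "exp (2 * c) * exp (- (v + c / v)\<^sup>2) = exp (- v\<^sup>2) * exp (- (c / v)\<^sup>2)"
      using that by (simp add: exp_add[symmetric] power2_sum)
    have d1: "((\<lambda>v. c / v) has_real_derivative - (c / v\<^sup>2)) (at v)"
      using that by (auto intro!: derivative_eq_intros simp: power2_eq_square)
    have dg: "((\<lambda>v. g (v - c / v)) has_real_derivative exp (- (v - c / v)\<^sup>2) * (1 - - (c / v\<^sup>2))) (at v)"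
      "((\<lambda>v. g (v + c / v)) has_real_derivative exp (- (v + c / v)\<^sup>2) * (1 + - (c / v\<^sup>2))) (at v)"
      by (intro DERIV_chain2[OF g(1)] DERIV_diff DERIV_add d1 DERIV_ident)+
    have dd: "((\<lambda>v. sqrt pi / 2 - g (c / v)) has_real_derivative - (exp (- (c / v)\<^sup>2) * - (c / v\<^sup>2))) (at v)"
      using DERIV_diff[OF DERIV_const DERIV_chain2[OF g(1) d1]] by simp
    have de: "((\<lambda>v. 2 * exp (- v\<^sup>2)) has_real_derivative 2 * (- 2 * v * exp (- v\<^sup>2))) (at v)"
      by (auto intro!: derivative_eq_intros)
    have dm: "((\<lambda>v. 2 * exp (- v\<^sup>2) * (sqrt pi / 2 - g (c / v))) has_real_derivative
        (2 * (- 2 * v * exp (- v\<^sup>2))) * (sqrt pi / 2 - g (c / v))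
        + (2 * exp (- v\<^sup>2)) * (- (exp (- (c / v)\<^sup>2) * - (c / v\<^sup>2)))) (at v)"
      using DERIV_mult[OF de dd] by (simp add: mult_ac)
    have "(F has_real_derivative (- ((2 * (- 2 * v * exp (- v\<^sup>2))) * (sqrt pi / 2 - g (c / v))
        + (2 * exp (- v\<^sup>2)) * (- (exp (- (c / v)\<^sup>2) * - (c / v\<^sup>2))))
      + exp (- (2 * c)) * (exp (- (v - c / v)\<^sup>2) * (1 - - (c / v\<^sup>2)))
      - exp (2 * c) * (exp (- (v + c / v)\<^sup>2) * (1 + - (c / v\<^sup>2)))) / sqrt pi) (at v)"
      unfolding F_def
      by (intro DERIV_cdivide DERIV_diff DERIV_add DERIV_minus DERIV_cmult dg dm)
    also have "(- ((2 * (- 2 * v * exp (- v\<^sup>2))) * (sqrt pi / 2 - g (c / v))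
        + (2 * exp (- v\<^sup>2)) * (- (exp (- (c / v)\<^sup>2) * - (c / v\<^sup>2))))
      + exp (- (2 * c)) * (exp (- (v - c / v)\<^sup>2) * (1 - - (c / v\<^sup>2)))
      - exp (2 * c) * (exp (- (v + c / v)\<^sup>2) * (1 + - (c / v\<^sup>2)))) / sqrt pi = f v"
      unfolding f_def mult.assoc[symmetric] e1 e2 by (simp add: field_simps)
    finally show ?thesis .
  qed
  have cv0: "filterlim (\<lambda>v. c / v) at_top (at_right 0)"
    using c by real_asymp
  have lims0: "filterlim (\<lambda>v. v - c / v) at_bot (at_right 0)" "filterlim (\<lambda>v. v + c / v) at_top (at_right 0)"
    using c by real_asymp+
  have lims1: "filterlim (\<lambda>v. v - c / v) at_top at_top" "filterlim (\<lambda>v. v + c / v) at_top at_top"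
    "((\<lambda>v. c / v) \<longlongrightarrow> 0) at_top" "((\<lambda>v::real. exp (- v\<^sup>2)) \<longlongrightarrow> 0) at_top"
    using c by real_asymp+
  have F0: "(F \<longlongrightarrow> (- (2 * exp (- 0\<^sup>2) * (sqrt pi / 2 - sqrt pi / 2)) + exp (- (2 * c)) * (- (sqrt pi / 2)) - exp (2 * c) * (sqrt pi / 2)) / sqrt pi) (at_right 0)"
    unfolding F_def
    by (intro tendsto_intros filterlim_compose[OF g(3) cv0] filterlim_compose[OF g(4) lims0(1)] filterlim_compose[OF g(3) lims0(2)]) auto
  have F1: "(F \<longlongrightarrow> (- (2 * 0 * (sqrt pi / 2 - g 0)) + exp (- (2 * c)) * (sqrt pi / 2) - exp (2 * c) * (sqrt pi / 2)) / sqrt pi) at_top"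
    unfolding F_def
    by (intro tendsto_intros filterlim_compose[OF g(3) lims1(1)] filterlim_compose[OF g(3) lims1(2)] isCont_tendsto_compose[OF gcont] lims1) auto
  have fcont: "isCont f v" if "0 < v" for v
    unfolding f_def using that by (intro continuous_intros isCont_o2[OF _ gcont]) auto
  have fnn: "0 \<le> f v" if "0 < v" for v
    unfolding f_def using that gle[of "c / v"] by (intro mult_nonneg_nonneg divide_nonneg_nonneg) auto
  note FTC = interval_integral_FTC_nonneg[of 0 \<infinity> F f, OF _ F fcont _ 
      F0[unfolded ereal_tendsto_simps1(2)[symmetric] zero_ereal_def[symmetric]] F1[unfolded ereal_tendsto_simps1(3)[symmetric]]]
  have ei: "einterval 0 \<infinity> = {0::real<..}" by (auto simp: einterval_def)
  have int: "set_integrable lborel {0<..} f" unfolding ei[symmetric]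
    by (rule FTC(1)) (auto simp: fnn)
  \<comment> \<open>Between the two limits of \<open>F\<close> the terms with exp(2 c) cancel, and
    two halves of exp(-2 c) add up.\<close>
  have "(LBINT x=0..\<infinity>. f x) = exp (- (2 * c))"
    by (subst FTC(2)) (auto simp: fnn field_simps)
  then have val: "(LINT v:{0<..}|lborel. f v) = exp (- (2 * c))"
    by (simp add: interval_lebesgue_integral_def ei)
  have "(\<integral>\<^sup>+v. ennreal (2 * v * exp (- v\<^sup>2) / sqrt pi) * (\<integral>\<^sup>+t. ennreal (exp (- (\<bar>t\<bar> + c / v)\<^sup>2)) \<partial>lborel)
    * indicator {0<..} v \<partial>lborel) = (\<integral>\<^sup>+v. ennreal (indicator {0<..} v *\<^sub>R f v) \<partial>lborel)"
    using gle unfolding f_def nn_integral_gaussian_abs_shift(1)[OF g(1,3)]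
    by (intro nn_integral_cong) (auto simp: ennreal_mult'[symmetric] split: split_indicator)
  also have "\<dots> = ennreal (exp (- (2 * c)))"
    using int val fnn unfolding set_integrable_def set_lebesgue_integral_def
    by (subst nn_integral_eq_integral) (auto split: split_indicator)
  finally show ?thesis .
qed

section \<open>The exponential kernel as a mixture of ball intersections\<close>

text \<open>
  The pair \<open>(v, s)\<close> stands for the radius \<open>v * s\<close>: integrating out \<open>s\<close> turns
  the indicator of \<open>m < v * s\<close> into \<open>exp (- (m / v)\<^sup>2)\<close>, and the remaining mixture over \<open>v\<close> is the
  subordination formula \<open>nn_integral_exp_subordination\<close>.
\<close>
definition radius_density :: "nat \<Rightarrow> real \<times> real \<Rightarrow> real" where
  "radius_density n = (\<lambda>(v, s). indicator {0<..} v * indicator {0<..} s *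
    (4 * v * s * exp (- v\<^sup>2) * exp (- s\<^sup>2) / (sqrt pi * v) ^ n))"

text \<open>The image of this measure under \<open>radius\<close> is the N of the overview. Its
  density in r is a power of r times a modified Bessel function, whereas on pairs the density is
  elementary.\<close>

definition radius_measure :: "nat \<Rightarrow> (real \<times> real) measure" where
  "radius_measure n = density lborel (\<lambda>p. ennreal (radius_density n p))"

text \<open>The absolute value makes the radius nonnegative for every pair and not only where the
  density is positive, so bounds hold pointwise.\<close>

definition radius :: "real \<times> real \<Rightarrow> real" where
  "radius p = \<bar>fst p * snd p\<bar>"

lemma radius_nonneg [simp]: "0 \<le> radius p"
  by (simp add: radius_def)

lemma measurable_radius [measurable]: "radius \<in> borel_measurable (radius_measure n)"
proof -
  have "continuous_on UNIV radius"
    unfolding radius_def[abs_def] by (intro continuous_intros)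
  then show ?thesis
    unfolding radius_measure_def by (simp add: borel_measurable_continuous_onI)
qed

lemma measurable_radius_density [measurable]: "radius_density n \<in> borel_measurable borel"
  unfolding radius_density_def by (simp add: borel_prod[symmetric])

lemma sigma_finite_radius_measure: "sigma_finite_measure (radius_measure n)"
  unfolding radius_measure_def
  by (subst sigma_finite_measure.sigma_finite_iff_density_finite[OF sigma_finite_lborel]) auto

lemma nn_integral_radius_measure:
  assumes [measurable]: "f \<in> borel_measurable (borel :: real measure)"
  shows "(\<integral>\<^sup>+p. f (radius p) \<partial>radius_measure n) = (\<integral>\<^sup>+v. \<integral>\<^sup>+s.
    ennreal (4 * v * s * exp (- v\<^sup>2) * exp (- s\<^sup>2) / (sqrt pi * v) ^ n) * f (v * s)
      * indicator {0<..} s * indicator {0<..} v \<partial>lborel \<partial>lborel)"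
proof -
  have "(\<lambda>p. f (radius p)) \<in> borel_measurable (radius_measure n)" by measurable
  then have [measurable]: "(\<lambda>p. f (radius p)) \<in> borel_measurable borel"
    by (simp add: radius_measure_def)
  have "(\<integral>\<^sup>+p. f (radius p) \<partial>radius_measure n) = (\<integral>\<^sup>+p. ennreal (radius_density n p) * f (radius p) \<partial>(lborel \<Otimes>\<^sub>M lborel))"
    unfolding radius_measure_def lborel_prod by (subst nn_integral_density) auto
  also have "\<dots> = (\<integral>\<^sup>+v. \<integral>\<^sup>+s. ennreal (radius_density n (v, s)) * f (radius (v, s)) \<partial>lborel \<partial>lborel)"
    by (rule lborel.nn_integral_fst[symmetric]) (simp add: lborel_prod)
  also have "\<dots> = (\<integral>\<^sup>+v. \<integral>\<^sup>+s.
    ennreal (4 * v * s * exp (- v\<^sup>2) * exp (- s\<^sup>2) / (sqrt pi * v) ^ n) * f (v * s)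
      * indicator {0<..} s * indicator {0<..} v \<partial>lborel \<partial>lborel)"
    by (intro nn_integral_cong) (auto simp: radius_density_def radius_def split: split_indicator)
  finally show ?thesis .
qed

text \<open>The integral splits into Gaussian moments in \<open>v\<close> and in \<open>s\<close>.
  The density behaves like v^(1 - n) near 0, and \<open>n \<le> k + 1\<close> keeps the exponent
  \<open>k + 1 - n\<close> of \<open>v\<close> a genuine, nonnegative difference.\<close>

lemma nn_integral_radius_power_finite:
  assumes "n \<le> k + 1"
  shows "(\<integral>\<^sup>+p. ennreal (radius p ^ k) \<partial>radius_measure n) < \<infinity>"
proof -
  have fin: "(\<integral>\<^sup>+x. ennreal (exp (- x\<^sup>2) * x ^ j) * indicator {0<..} x \<partial>lborel) < \<infinity>" for j
  proof -
    have "\<exists>r. has_bochner_integral lborel (\<lambda>x::real. indicator {0..} x *\<^sub>R (exp (- x\<^sup>2) * x ^ j)) r"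
    proof (cases "even j")
      case True
      then obtain i where "j = 2 * i" by (auto elim: evenE)
      with gaussian_moment_even_pos[of i] show ?thesis by auto
    next
      case False
      then obtain i where "j = 2 * i + 1" by (auto elim: oddE)
      with gaussian_moment_odd_pos[of i] show ?thesis by auto
    qed
    then have "integrable lborel (\<lambda>x::real. indicator {0..} x *\<^sub>R (exp (- x\<^sup>2) * x ^ j))"
      by (auto intro: integrable.intros)
    then have "(\<integral>\<^sup>+x. ennreal (norm (indicator {0..} x *\<^sub>R (exp (- x\<^sup>2) * x ^ j) :: real)) \<partial>(lborel :: real measure)) < \<infinity>"
      by (simp add: integrable_iff_bounded)
    moreover have "(\<integral>\<^sup>+x. ennreal (exp (- x\<^sup>2) * x ^ j) * indicator {0<..} x \<partial>lborel) \<le>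
      (\<integral>\<^sup>+x. ennreal (norm (indicator {0..} x *\<^sub>R (exp (- x\<^sup>2) * x ^ j) :: real)) \<partial>(lborel :: real measure))"
      by (intro nn_integral_mono) (auto split: split_indicator)
    ultimately show ?thesis by (rule le_less_trans[rotated])
  qed
  have "(\<integral>\<^sup>+p. ennreal (radius p ^ k) \<partial>radius_measure n) = (\<integral>\<^sup>+v. \<integral>\<^sup>+s.
      ennreal (4 / sqrt pi ^ n) * (ennreal (exp (- v\<^sup>2) * v ^ (k + 1 - n)) * indicator {0<..} v) *
      (ennreal (exp (- s\<^sup>2) * s ^ (k + 1)) * indicator {0<..} s) \<partial>lborel \<partial>lborel)"
  proof (subst nn_integral_radius_measure, measurable, intro nn_integral_cong)
    fix v s :: real
    show "ennreal (4 * v * s * exp (- v\<^sup>2) * exp (- s\<^sup>2) / (sqrt pi * v) ^ n) * ennreal ((v * s) ^ k)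
        * indicator {0<..} s * indicator {0<..} v =
      ennreal (4 / sqrt pi ^ n) * (ennreal (exp (- v\<^sup>2) * v ^ (k + 1 - n)) * indicator {0<..} v) *
      (ennreal (exp (- s\<^sup>2) * s ^ (k + 1)) * indicator {0<..} s)"
    proof (cases "0 < v \<and> 0 < s")
      case True
      have "v ^ (k + 1 - n) = v ^ (k + 1) / v ^ n"
        using True assms by (simp add: power_diff del: power_Suc)
      then have "4 * v * s * exp (- v\<^sup>2) * exp (- s\<^sup>2) / (sqrt pi * v) ^ n * (v * s) ^ k
        = 4 / sqrt pi ^ n * (exp (- v\<^sup>2) * v ^ (k + 1 - n)) * (exp (- s\<^sup>2) * s ^ (k + 1))"
        by (simp add: power_mult_distrib)
      with True show ?thesis by (simp add: ennreal_mult'[symmetric])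
    qed (auto split: split_indicator)
  qed
  also have "\<dots> = ennreal (4 / sqrt pi ^ n) * (\<integral>\<^sup>+v. ennreal (exp (- v\<^sup>2) * v ^ (k + 1 - n)) * indicator {0<..} v \<partial>lborel)
     * (\<integral>\<^sup>+s. ennreal (exp (- s\<^sup>2) * s ^ (k + 1)) * indicator {0<..} s \<partial>lborel)"
    by (simp add: nn_integral_cmult nn_integral_multc)
  also have "\<dots> < \<infinity>"
    using fin[of "k + 1 - n"] fin[of "k + 1"] by (simp add: ennreal_mult_less_top)
  finally show ?thesis .
qed

section \<open>Lebesgue measure under rigid motions, and the mixture formula\<close>

lemma nn_integral_lborel_translation:
  fixes f :: "'a::euclidean_space \<Rightarrow> ennreal"
  assumes [measurable]: "f \<in> borel_measurable borel"
  shows "(\<integral>\<^sup>+x. f (c + x) \<partial>lborel) = (\<integral>\<^sup>+x. f x \<partial>lborel)"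
proof -
  have "(\<integral>\<^sup>+x. f x \<partial>lborel) = (\<integral>\<^sup>+x. f x \<partial>distr lborel borel ((+) c))"
    by (simp add: lborel_distr_plus)
  also have "\<dots> = (\<integral>\<^sup>+x. f (c + x) \<partial>lborel)"
    by (rule nn_integral_distr) auto
  finally show ?thesis ..
qed

lemma emeasure_lborel_translation:
  fixes A :: "'a::euclidean_space set"
  assumes "A \<in> sets borel"
  shows "emeasure lborel ((\<lambda>x. c + x) -` A) = emeasure lborel A"
  using emeasure_distr[of "(+) c" lborel borel A] assms by (simp add: lborel_distr_plus)

text \<open>Comparing \<open>A\<close> with the unit ball by Tonelli and translation invariance avoids determinants,
  for which the library needs an ordering of the coordinates.\<close>
lemma emeasure_lborel_vimage_orthogonal:
  fixes f :: "'a::euclidean_space \<Rightarrow> 'a"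
  assumes f: "orthogonal_transformation f" and [measurable]: "A \<in> sets borel"
  shows "emeasure lborel (f -` A) = emeasure lborel A"
proof -
  let ?B = "ball 0 1 :: 'a set"
  define g where "g = inv f"
  have lin: "linear f" using f by (rule orthogonal_transformation_linear)
  have [measurable]: "f \<in> borel_measurable borel"
    using lin by (intro borel_measurable_continuous_onI linear_continuous_on) (simp add: linear_conv_bounded_linear)
  have [measurable]: "(indicator A :: 'a \<Rightarrow> ennreal) \<in> borel_measurable borel"
    "(indicator ?B :: 'a \<Rightarrow> ennreal) \<in> borel_measurable borel"
    by (auto intro!: borel_measurable_indicator)
  have fg: "f (g y) = y" for y
    unfolding g_def using orthogonal_transformation_surj[OF f] by (rule surj_f_inv_f)
  have [measurable]: "f -` A \<in> sets borel"
    using measurable_sets_borel[of f borel A] by simp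
  have dist_f: "dist (f x) (f y) = dist x y" for x y
    using f by (simp add: dist_norm linear_diff[OF lin, symmetric] orthogonal_transformation_norm)
  have "emeasure lborel (f -` A) * emeasure lborel ?B = (\<integral>\<^sup>+y. indicator ?B y * emeasure lborel (f -` A) \<partial>lborel)"
    by (subst nn_integral_multc) (auto simp: mult.commute intro!: borel_measurable_indicator)
  \<comment> \<open>The pairs (x, y) with \<open>y\<close> in the unit ball and
    \<open>y + f x\<close> in \<open>A\<close> are measured in two ways. For fixed \<open>y\<close>
    the admissible \<open>x\<close> form a translate of the preimage of \<open>A\<close>. After
    replacing \<open>y\<close> by \<open>y - f x\<close>, for fixed \<open>y\<close> in
    \<open>A\<close> they form the unit ball about \<open>g y\<close>, because \<open>f\<close> is
    an isometry.\<close>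
  also have "\<dots> = (\<integral>\<^sup>+y. \<integral>\<^sup>+x. indicator ?B y * indicator A (y + f x) \<partial>lborel \<partial>lborel)"
  proof (intro nn_integral_cong)
    fix y
    have "(\<integral>\<^sup>+x. indicator A (y + f x) \<partial>lborel) = (\<integral>\<^sup>+x. indicator (f -` A) (g y + x) \<partial>lborel)"
      by (intro nn_integral_cong) (simp add: indicator_def linear_add[OF lin] fg)
    also have "\<dots> = (\<integral>\<^sup>+x. indicator (f -` A) x \<partial>lborel)"
      by (rule nn_integral_lborel_translation) measurable
    finally show "indicator ?B y * emeasure lborel (f -` A) = (\<integral>\<^sup>+x. indicator ?B y * indicator A (y + f x) \<partial>lborel)"
      by (simp add: nn_integral_cmult)
  qed
  also have "\<dots> = (\<integral>\<^sup>+x. \<integral>\<^sup>+y. indicator ?B y * indicator A (y + f x) \<partial>lborel \<partial>lborel)"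
    by (rule lborel_pair.Fubini') measurable
  also have "\<dots> = (\<integral>\<^sup>+x. \<integral>\<^sup>+y. indicator ?B (y - f x) * indicator A y \<partial>lborel \<partial>lborel)"
  proof (rule nn_integral_cong)
    fix x
    have "(\<integral>\<^sup>+y. indicator ?B (y - f x) * indicator A y \<partial>lborel) =
      (\<integral>\<^sup>+y. indicator ?B ((f x + y) - f x) * indicator A (f x + y) \<partial>lborel)"
      by (rule nn_integral_lborel_translation[symmetric]) measurable
    then show "(\<integral>\<^sup>+y. indicator ?B y * indicator A (y + f x) \<partial>lborel) = (\<integral>\<^sup>+y. indicator ?B (y - f x) * indicator A y \<partial>lborel)"
      by (simp add: add.commute)
  qed
  also have "\<dots> = (\<integral>\<^sup>+y. \<integral>\<^sup>+x. indicator ?B (y - f x) * indicator A y \<partial>lborel \<partial>lborel)"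
    by (rule lborel_pair.Fubini'[symmetric]) measurable
  also have "\<dots> = (\<integral>\<^sup>+y. emeasure lborel ?B * indicator A y \<partial>lborel)"
  proof (rule nn_integral_cong)
    fix y
    have "(\<integral>\<^sup>+x. indicator ?B (y - f x) * indicator A y \<partial>lborel) = (\<integral>\<^sup>+x. indicator (ball (g y) 1) x * indicator A y \<partial>lborel)"
    proof (rule nn_integral_cong)
      fix x
      have "norm (y - f x) = dist (g y) x" using dist_f[of "g y" x] by (simp add: fg dist_norm)
      then show "indicator ?B (y - f x) * indicator A y = (indicator (ball (g y) 1) x * indicator A y :: ennreal)"
        by (simp add: indicator_def)
    qed
    also have "\<dots> = emeasure lborel (ball (g y) 1) * indicator A y"
      by (subst nn_integral_multc) (auto intro!: borel_measurable_indicator)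
    finally show "(\<integral>\<^sup>+x. indicator ?B (y - f x) * indicator A y \<partial>lborel) = emeasure lborel ?B * indicator A y"
      by (simp add: emeasure_ball)
  qed
  also have "\<dots> = emeasure lborel A * emeasure lborel ?B"
    by (subst nn_integral_cmult) (auto simp: mult.commute intro!: borel_measurable_indicator)
  finally have "emeasure lborel (f -` A) * emeasure lborel ?B = emeasure lborel A * emeasure lborel ?B" .
  moreover have "emeasure lborel ?B \<noteq> 0" "emeasure lborel ?B \<noteq> top"
    by (simp_all add: emeasure_ball unit_ball_vol_pos[THEN less_imp_neq, THEN not_sym])
  ultimately show ?thesis by (metis mult_divide_eq_ennreal)
qed

text \<open>A rigid motion carries one pair of centres to the other: \<open>f\<close> turns
  \<open>x - y\<close> into \<open>a - b\<close>, and the translation by \<open>t\<close> then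
  matches the points. This permits placing the centres symmetrically on a coordinate axis.\<close>

lemma emeasure_ball_Int_ball_cong:
  fixes x y a b :: "real ^ 'n"
  assumes "dist x y = dist a b"
  shows "emeasure lborel (ball x r \<inter> ball y r) = emeasure lborel (ball a r \<inter> ball b r)"
proof -
  obtain f where f: "orthogonal_transformation f" "f (x - y) = a - b"
    using assms unfolding dist_norm by (rule orthogonal_transformation_exists)
  define t where "t = a - f x"
  have lin: "linear f" using f(1) by (rule orthogonal_transformation_linear)
  have "f x - f y = a - b" using f(2) linear_diff[OF lin] by metis
  then have t: "a = t + f x" "b = t + f y"
    unfolding t_def by (simp_all add: diff_eq_eq)
  have dist_f: "dist (f x) (f y) = dist x y" for x y
    using f(1) by (simp add: dist_norm linear_diff[OF lin, symmetric] orthogonal_transformation_norm)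
  have eq: "ball x r \<inter> ball y r = f -` (\<lambda>z. t + z) -` (ball a r \<inter> ball b r)"
    by (auto simp: t dist_f)
  have meas: "(\<lambda>z. t + z) -` (ball a r \<inter> ball b r) \<in> sets borel"
    using measurable_sets_borel[of "(+) t" borel "ball a r \<inter> ball b r"] by simp
  show ?thesis
    unfolding eq emeasure_lborel_vimage_orthogonal[OF f(1) meas]
    by (rule emeasure_lborel_translation) simp
qed

text \<open>The squared maximum of the two norms is (|z . e| + c)^2 plus the squares of the
  remaining coordinates, so the integrand is a product over coordinates. Each remaining coordinate
  contributes \<open>sqrt pi * v\<close>.\<close>

lemma nn_integral_gaussian_max_norm:
  fixes k :: "'n::finite"
  assumes v: "0 < v" and c: "0 \<le> c"
  shows "(\<integral>\<^sup>+z. ennreal (exp (- (max (norm (z - axis k c)) (norm (z + axis k c)) / v)\<^sup>2)) \<partial>(lborel :: (real ^ 'n) measure))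
    = ennreal ((sqrt pi * v) ^ (CARD('n) - 1) * v) * (\<integral>\<^sup>+t. ennreal (exp (- (\<bar>t\<bar> + c / v)\<^sup>2)) \<partial>lborel)"
proof -
  let ?B = "Basis :: (real ^ 'n) set"
  define e where "e = (axis k 1 :: real ^ 'n)"
  have e: "e \<in> ?B" by (simp add: e_def axis_in_Basis_iff)
  have cd: "card (?B - {e}) = CARD('n) - 1"
    using e by (simp add: card_Diff_singleton)
  define h where "h b t = ennreal (if b = e then exp (- ((\<bar>t\<bar> + c) / v)\<^sup>2) else exp (- (t / v)\<^sup>2))" for b :: "real ^ 'n" and t
  have ax: "axis k c = c *\<^sub>R e"
    by (simp add: e_def vec_eq_iff axis_def)
  have "ennreal (exp (- (max (norm (z - axis k c)) (norm (z + axis k c)) / v)\<^sup>2)) = (\<Prod>b\<in>?B. h b (z \<bullet> b))" for z :: "real ^ 'n"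
  proof -
    have ee: "e \<bullet> e = 1" using e by (simp add: inner_Basis)
    have sq: "(norm z)\<^sup>2 = (z \<bullet> e)\<^sup>2 + (\<Sum>b\<in>?B - {e}. (z \<bullet> b)\<^sup>2)"
    proof -
      have "(norm z)\<^sup>2 = (\<Sum>b\<in>?B. (z \<bullet> b)\<^sup>2)"
        unfolding power2_norm_eq_inner by (subst euclidean_inner) (simp add: power2_eq_square)
      then show ?thesis using e by (simp add: sum.remove)
    qed
    have "(norm (z - axis k c))\<^sup>2 = (norm z)\<^sup>2 + c\<^sup>2 - 2 * c * (z \<bullet> e)"
         "(norm (z + axis k c))\<^sup>2 = (norm z)\<^sup>2 + c\<^sup>2 + 2 * c * (z \<bullet> e)"
      unfolding ax power2_norm_eq_inner using ee
      by (simp_all add: algebra_simps inner_commute power2_eq_square)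
    moreover have "(max a b)\<^sup>2 = max (a\<^sup>2) (b\<^sup>2)" if "0 \<le> a" "0 \<le> b" for a b :: real
      using that by (auto simp: max_def power_mono_iff)
    moreover have "max (r - q) (r + q) = r + \<bar>q\<bar>" for r q :: real by (simp add: max_def)
    ultimately have "(max (norm (z - axis k c)) (norm (z + axis k c)))\<^sup>2 = (norm z)\<^sup>2 + c\<^sup>2 + 2 * c * \<bar>z \<bullet> e\<bar>"
      using c by (simp add: abs_mult)
    also have "\<dots> = (\<bar>z \<bullet> e\<bar> + c)\<^sup>2 + (\<Sum>b\<in>?B - {e}. (z \<bullet> b)\<^sup>2)"
      unfolding sq by (simp add: power2_sum algebra_simps)
    finally have sq2: "(max (norm (z - axis k c)) (norm (z + axis k c)))\<^sup>2 = (\<bar>z \<bullet> e\<bar> + c)\<^sup>2 + (\<Sum>b\<in>?B - {e}. (z \<bullet> b)\<^sup>2)" .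
    have "- (max (norm (z - axis k c)) (norm (z + axis k c)) / v)\<^sup>2 =
      - ((\<bar>z \<bullet> e\<bar> + c) / v)\<^sup>2 + (\<Sum>b\<in>?B - {e}. - (z \<bullet> b / v)\<^sup>2)"
      unfolding power_divide sq2 sum_negf sum_divide_distrib[symmetric]
      by (simp only: add_divide_distrib[of _ _ "v\<^sup>2"] minus_add_distrib)
    then have "exp (- (max (norm (z - axis k c)) (norm (z + axis k c)) / v)\<^sup>2) =
      exp (- ((\<bar>z \<bullet> e\<bar> + c) / v)\<^sup>2) * (\<Prod>b\<in>?B - {e}. exp (- (z \<bullet> b / v)\<^sup>2))"
      by (simp only: exp_add) (simp add: exp_sum)
    also have "ennreal \<dots> = h e (z \<bullet> e) * (\<Prod>b\<in>?B - {e}. h b (z \<bullet> b))"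
      by (simp add: h_def ennreal_mult' prod_ennreal)
    also have "\<dots> = (\<Prod>b\<in>?B. h b (z \<bullet> b))" using e by (simp add: prod.remove)
    finally show ?thesis .
  qed
  then have "(\<integral>\<^sup>+z. ennreal (exp (- (max (norm (z - axis k c)) (norm (z + axis k c)) / v)\<^sup>2)) \<partial>(lborel :: (real ^ 'n) measure))
     = (\<Prod>b\<in>?B. \<integral>\<^sup>+t. h b t \<partial>lborel)"
    by (simp only: nn_integral_lborel_prod[of h]) (rule nn_integral_lborel_prod, auto simp: h_def)
  also have "\<dots> = (\<integral>\<^sup>+t. h e t \<partial>lborel) * (\<Prod>b\<in>?B - {e}. \<integral>\<^sup>+t. h b t \<partial>lborel)"
    using e by (simp add: prod.remove)
  also have "(\<Prod>b\<in>?B - {e}. \<integral>\<^sup>+t. h b t \<partial>lborel) = (\<Prod>b\<in>?B - {e}. ennreal (sqrt pi * v))"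
  proof (rule prod.cong[OF refl])
    fix b assume "b \<in> ?B - {e}"
    then have "(\<integral>\<^sup>+t. h b t \<partial>lborel) = (\<integral>\<^sup>+t. ennreal (exp (- (t / v)\<^sup>2)) \<partial>lborel)"
      by (simp add: h_def)
    also have "\<dots> = ennreal v * (\<integral>\<^sup>+t. ennreal (exp (- t\<^sup>2)) \<partial>lborel)"
      using v by (subst nn_integral_real_affine[where c=v and t=0]) auto
    finally show "(\<integral>\<^sup>+t. h b t \<partial>lborel) = ennreal (sqrt pi * v)"
      using v by (simp add: nn_integral_gaussian ennreal_mult' mult.commute)
  qed
  also have "\<dots> = ennreal ((sqrt pi * v) ^ (CARD('n) - 1))"
    using v cd by (simp add: ennreal_power)
  also have "(\<integral>\<^sup>+t. h e t \<partial>lborel) = ennreal v * (\<integral>\<^sup>+t. ennreal (exp (- (\<bar>t\<bar> + c / v)\<^sup>2)) \<partial>lborel)"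
    unfolding h_def using v
    by (subst nn_integral_real_affine[where c=v and t=0]) (auto simp: add_divide_distrib abs_mult)
  finally show ?thesis using v by (simp add: ennreal_mult' mult_ac)
qed

lemma measurable_emeasure_ball_Int_ball: "(\<lambda>r. emeasure lborel (ball x r \<inter> ball y r)) \<in> borel_measurable (borel :: real measure)"
  for x y :: "'a::euclidean_space"
proof -
  have "(\<lambda>r. emeasure lborel (ball x r \<inter> ball y r)) = (\<lambda>r::real. \<integral>\<^sup>+z. indicator {p. dist x (snd p) < fst p \<and> dist y (snd p) < fst p} (r, z) \<partial>lborel)"
    by (auto simp: nn_integral_indicator[symmetric] fun_eq_iff simp del: nn_integral_indicator intro!: nn_integral_cong split: split_indicator)
  also have "\<dots> \<in> borel_measurable borel"
    by measurable
  finally show ?thesis .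
qed

lemma nn_integral_ball_Int_ball:
  fixes x y :: "real ^ 'n"
  shows "(\<integral>\<^sup>+p. emeasure lborel (ball x (radius p) \<inter> ball y (radius p)) \<partial>radius_measure (CARD('n)))
    = ennreal (exp (- dist x y))"
proof -
  obtain k :: 'n where True by blast
  \<comment> \<open>Half the distance: the centres are moved to plus and minus \<open>c\<close> on
    one axis, and the factor 2 in the exponent of the subordination formula restores the full
    distance.\<close>
  define c where "c = dist x y / 2"
  define m where "m z = max (norm (z - axis k c)) (norm (z + axis k c))" for z :: "real ^ 'n"
  let ?N = "CARD('n)"
  let ?V = "\<lambda>r. emeasure lborel (ball (axis k c :: real ^ 'n) r \<inter> ball (- axis k c) r)"
  have c: "0 \<le> c" by (simp add: c_def)
  have [measurable]: "m \<in> borel_measurable borel" unfolding m_def[abs_def] by measurable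
  have m0: "0 \<le> m z" for z unfolding m_def by (rule max.coboundedI1) simp
  have "dist (axis k c) (- axis k c :: real ^ 'n) = dist x y"
  proof -
    have "axis k c - (- axis k c :: real ^ 'n) = dist x y *\<^sub>R axis k 1"
      by (simp add: vec_eq_iff axis_def c_def)
    then have "dist (axis k c) (- axis k c :: real ^ 'n) = norm (dist x y *\<^sub>R (axis k 1 :: real ^ 'n))"
      unfolding dist_norm[of "axis k c"] by (rule arg_cong)
    then show ?thesis by (simp only: norm_scaleR norm_axis_1) simp
  qed
  then have eq: "emeasure lborel (ball x r \<inter> ball y r) = ?V r" for r
    by (intro emeasure_ball_Int_ball_cong) simp
  have V: "?V r = (\<integral>\<^sup>+z. indicator {z. m z < r} z \<partial>lborel)" for r
    by (auto simp: nn_integral_indicator[symmetric] m_def dist_norm norm_minus_commute add.commute simp del: nn_integral_indicator intro!: nn_integral_cong split: split_indicator)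
  have inner: "(\<integral>\<^sup>+s. ennreal (2 * s * exp (- s\<^sup>2)) * indicator {0<..} s * ?V (v * s) \<partial>lborel) =
      ennreal ((sqrt pi * v) ^ (?N - 1) * v) * (\<integral>\<^sup>+t. ennreal (exp (- (\<bar>t\<bar> + c / v)\<^sup>2)) \<partial>lborel)"
    if v: "0 < v" for v
  proof -
    have "(\<integral>\<^sup>+s. ennreal (2 * s * exp (- s\<^sup>2)) * indicator {0<..} s * ?V (v * s) \<partial>lborel) =
      (\<integral>\<^sup>+s. \<integral>\<^sup>+z. ennreal (2 * s * exp (- s\<^sup>2)) * indicator {0<..} s * indicator {z. m z < v * s} z \<partial>lborel \<partial>lborel)"
      unfolding V by (intro nn_integral_cong) (simp add: nn_integral_cmult)
    also have "\<dots> = (\<integral>\<^sup>+z. \<integral>\<^sup>+s. ennreal (2 * s * exp (- s\<^sup>2)) * indicator {0<..} s * indicator {z. m z < v * s} z \<partial>lborel \<partial>lborel)"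
      by (rule lborel_pair.Fubini') measurable
    also have "\<dots> = (\<integral>\<^sup>+z. ennreal (exp (- (m z / v)\<^sup>2)) \<partial>lborel)"
    proof (rule nn_integral_cong)
      fix z
      have "(\<integral>\<^sup>+s. ennreal (2 * s * exp (- s\<^sup>2)) * indicator {0<..} s * indicator {z. m z < v * s} z \<partial>lborel)
        = (\<integral>\<^sup>+s. ennreal (2 * s * exp (- s\<^sup>2)) * indicator {m z / v..} s \<partial>lborel)"
      \<comment> \<open>The strict and the weak inequality differ only at
        \<open>s = m z / v\<close>. Positivity of \<open>s\<close> is implied elsewhere because
        \<open>m z / v\<close> is nonnegative.\<close>
      proof (intro nn_integral_cong_AE AE_I[where N="{m z / v}"] subsetI)
        fix s assume s: "s \<in> {s \<in> space lborel. \<not> (ennreal (2 * s * exp (- s\<^sup>2)) * indicator {0<..} s * indicator {z. m z < v * s} z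
          = ennreal (2 * s * exp (- s\<^sup>2)) * indicator {m z / v..} s)}"
        have "m z < v * s \<longleftrightarrow> m z / v < s" using v by (simp add: field_simps)
        moreover have "0 \<le> m z / v" using v m0[of z] by simp
        ultimately show "s \<in> {m z / v}" using s by (auto split: split_indicator_asm)
      qed auto
      also have "\<dots> = ennreal (exp (- (m z / v)\<^sup>2))"
        using v m0 by (intro nn_integral_two_exp_square) auto
      finally show "(\<integral>\<^sup>+s. ennreal (2 * s * exp (- s\<^sup>2)) * indicator {0<..} s * indicator {z. m z < v * s} z \<partial>lborel)
        = ennreal (exp (- (m z / v)\<^sup>2))" .
    qed
    finally show ?thesis unfolding m_def nn_integral_gaussian_max_norm[OF v c] .
  qed
  have [measurable]: "?V \<in> borel_measurable borel" by (rule measurable_emeasure_ball_Int_ball)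
  have "(\<integral>\<^sup>+p. emeasure lborel (ball x (radius p) \<inter> ball y (radius p)) \<partial>radius_measure ?N)
     = (\<integral>\<^sup>+v. \<integral>\<^sup>+s. ennreal (4 * v * s * exp (- v\<^sup>2) * exp (- s\<^sup>2) / (sqrt pi * v) ^ ?N) * ?V (v * s)
      * indicator {0<..} s * indicator {0<..} v \<partial>lborel \<partial>lborel)"
    unfolding eq by (rule nn_integral_radius_measure) measurable
  also have "\<dots> = (\<integral>\<^sup>+v. ennreal (2 * v * exp (- v\<^sup>2) / sqrt pi) * (\<integral>\<^sup>+t. ennreal (exp (- (\<bar>t\<bar> + c / v)\<^sup>2)) \<partial>lborel)
    * indicator {0<..} v \<partial>lborel)"
  proof (rule nn_integral_cong)
    fix v :: real
    show "(\<integral>\<^sup>+s. ennreal (4 * v * s * exp (- v\<^sup>2) * exp (- s\<^sup>2) / (sqrt pi * v) ^ ?N) * ?V (v * s)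
      * indicator {0<..} s * indicator {0<..} v \<partial>lborel) =
      ennreal (2 * v * exp (- v\<^sup>2) / sqrt pi) * (\<integral>\<^sup>+t. ennreal (exp (- (\<bar>t\<bar> + c / v)\<^sup>2)) \<partial>lborel) * indicator {0<..} v"
    proof (cases "0 < v")
      case v: True
      have "(\<integral>\<^sup>+s. ennreal (4 * v * s * exp (- v\<^sup>2) * exp (- s\<^sup>2) / (sqrt pi * v) ^ ?N) * ?V (v * s)
          * indicator {0<..} s * indicator {0<..} v \<partial>lborel) =
        (\<integral>\<^sup>+s. ennreal (2 * v * exp (- v\<^sup>2) / (sqrt pi * v) ^ ?N) *
          (ennreal (2 * s * exp (- s\<^sup>2)) * indicator {0<..} s * ?V (v * s)) \<partial>lborel)"
      proof (intro nn_integral_cong)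
        fix s
        have "4 * v * s * exp (- v\<^sup>2) * exp (- s\<^sup>2) / (sqrt pi * v) ^ ?N =
          2 * v * exp (- v\<^sup>2) / (sqrt pi * v) ^ ?N * (2 * s * exp (- s\<^sup>2))"
          by simp
        then have "ennreal (4 * v * s * exp (- v\<^sup>2) * exp (- s\<^sup>2) / (sqrt pi * v) ^ ?N) =
          ennreal (2 * v * exp (- v\<^sup>2) / (sqrt pi * v) ^ ?N) * ennreal (2 * s * exp (- s\<^sup>2))"
          using v by (metis ennreal_mult' divide_nonneg_nonneg exp_ge_zero less_imp_le mult_nonneg_nonneg pi_ge_zero
              real_sqrt_ge_zero zero_le_numeral zero_le_power)
        then show "ennreal (4 * v * s * exp (- v\<^sup>2) * exp (- s\<^sup>2) / (sqrt pi * v) ^ ?N) * ?V (v * s)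
            * indicator {0<..} s * indicator {0<..} v =
          ennreal (2 * v * exp (- v\<^sup>2) / (sqrt pi * v) ^ ?N) *
            (ennreal (2 * s * exp (- s\<^sup>2)) * indicator {0<..} s * ?V (v * s))"
          using v by (simp only: mult_ac) (simp split: split_indicator)
      qed
      also have "\<dots> = ennreal (2 * v * exp (- v\<^sup>2) / (sqrt pi * v) ^ ?N) *
          (\<integral>\<^sup>+s. ennreal (2 * s * exp (- s\<^sup>2)) * indicator {0<..} s * ?V (v * s) \<partial>lborel)"
        by (rule nn_integral_cmult) measurable
      also have "\<dots> = ennreal (2 * v * exp (- v\<^sup>2) / (sqrt pi * v) ^ ?N * ((sqrt pi * v) ^ (?N - 1) * v)) *
          (\<integral>\<^sup>+t. ennreal (exp (- (\<bar>t\<bar> + c / v)\<^sup>2)) \<partial>lborel)"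
        unfolding inner[OF v] mult.assoc[symmetric, of "ennreal _" "ennreal _"] using v by (subst ennreal_mult') simp_all
      \<comment> \<open>This cancellation is the purpose of dividing by
        \<open>(sqrt pi * v) ^ n\<close> in \<open>radius_density\<close>: the \<open>n - 1\<close>
        transverse coordinates disappear and one sqrt pi is left over.\<close>
      also have "2 * v * exp (- v\<^sup>2) / (sqrt pi * v) ^ ?N * ((sqrt pi * v) ^ (?N - 1) * v) = 2 * v * exp (- v\<^sup>2) / sqrt pi"
      proof -
        obtain j where "?N = Suc j" using zero_less_card_finite[where 'a='n] gr0_implies_Suc by blast
        with v show ?thesis by (simp add: field_simps)
      qed
      finally show ?thesis using v by simp
    qed simp
  qed
  also have "\<dots> = ennreal (exp (- (2 * c)))" by (rule nn_integral_exp_subordination[OF c])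
  finally show ?thesis by (simp add: c_def)
qed

section \<open>Upper bounds from neighbourhoods\<close>

abbreviation ball_features :: "(real ^ 'n) \<Rightarrow> ((real \<times> real) \<times> (real ^ 'n)) set" where
  "ball_features x \<equiv> {(p, z). dist x z < radius p}"

lemma space_radius_measure [simp]: "space (radius_measure n) = UNIV"
  by (simp add: radius_measure_def)

lemma sets_ball_features [measurable]:
  "ball_features x \<in> sets (radius_measure n \<Otimes>\<^sub>M lborel)"
proof -
  have "{q \<in> space (radius_measure n \<Otimes>\<^sub>M lborel). dist x (snd q) < radius (fst q)} \<in> sets (radius_measure n \<Otimes>\<^sub>M lborel)"
    by measurable
  then show ?thesis by (simp add: space_pair_measure case_prod_unfold)
qed

lemma exp_kernel_representation_balls:
  "exp_kernel_representation (radius_measure CARD('n) \<Otimes>\<^sub>M lborel) (ball_features :: real ^ 'n \<Rightarrow> _)"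
proof
  fix x y :: "real ^ 'n"
  have "emeasure (radius_measure CARD('n) \<Otimes>\<^sub>M lborel) (ball_features x \<inter> ball_features y) =
    (\<integral>\<^sup>+p. emeasure lborel (ball x (radius p) \<inter> ball y (radius p)) \<partial>radius_measure CARD('n))"
    by (subst lborel.emeasure_pair_measure_alt[OF sets.Int[OF sets_ball_features sets_ball_features]])
       (auto intro!: nn_integral_cong arg_cong[where f="emeasure lborel"])
  then show "emeasure (radius_measure CARD('n) \<Otimes>\<^sub>M lborel) (ball_features x \<inter> ball_features y) = ennreal (exp (- dist x y))"
    by (simp only: nn_integral_ball_Int_ball)
qed (rule sets_ball_features)

text \<open>Writing exp(-a) as the integral of exp(-t) over t >= a reduces this to volumes of balls;
  the factorial is the Gamma integral of t^n exp(-t).\<close>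

lemma nn_integral_exp_norm:
  "(\<integral>\<^sup>+x. ennreal (exp (- dist c x)) \<partial>(lborel :: (real ^ 'n) measure)) =
    ennreal (fact CARD('n) * unit_ball_vol CARD('n))"
proof -
  let ?n = "CARD('n)"
  have lim: "((\<lambda>t::real. - exp (- t)) \<longlongrightarrow> 0) at_top" by real_asymp
  have layer: "ennreal (exp (- a)) = (\<integral>\<^sup>+t. ennreal (exp (- t)) * indicator {a..} t \<partial>lborel)" for a :: real
    by (subst nn_integral_FTC_atLeast[where F="\<lambda>t. - exp (- t)" and T=0])
       (auto intro!: derivative_eq_intros lim)
  have "(\<integral>\<^sup>+x. ennreal (exp (- dist c x)) \<partial>(lborel :: (real ^ 'n) measure)) =
    (\<integral>\<^sup>+x. \<integral>\<^sup>+t. ennreal (exp (- t)) * indicator {q. dist c (fst q) \<le> snd q} (x, t) \<partial>lborel \<partial>lborel)"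
  proof (rule nn_integral_cong)
    fix x
    have "(\<integral>\<^sup>+t. ennreal (exp (- t)) * indicator {q. dist c (fst q) \<le> snd q} (x, t) \<partial>lborel) =
      (\<integral>\<^sup>+t. ennreal (exp (- t)) * indicator {dist c x..} t \<partial>lborel)"
      by (intro nn_integral_cong) (simp split: split_indicator)
    then show "ennreal (exp (- dist c x)) = (\<integral>\<^sup>+t. ennreal (exp (- t)) * indicator {q. dist c (fst q) \<le> snd q} (x, t) \<partial>lborel)"
      by (simp only: layer[symmetric])
  qed
  also have "\<dots> = (\<integral>\<^sup>+t. \<integral>\<^sup>+x. ennreal (exp (- t)) * indicator {q. dist c (fst q) \<le> snd q} (x, t) \<partial>lborel \<partial>lborel)"
    by (rule lborel_pair.Fubini'[symmetric]) measurable
  also have "\<dots> = (\<integral>\<^sup>+t. ennreal (unit_ball_vol ?n) * (ennreal (t ^ ?n * exp (- t)) * indicator {0..} t) \<partial>lborel)"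
  proof (rule nn_integral_cong)
    fix t :: real
    have "(\<integral>\<^sup>+x. ennreal (exp (- t)) * indicator {q. dist c (fst q) \<le> snd q} (x, t) \<partial>lborel) =
       (\<integral>\<^sup>+x. ennreal (exp (- t)) * indicator (cball c t) x \<partial>lborel)"
      by (intro nn_integral_cong) (simp split: split_indicator)
    also have "\<dots> = ennreal (exp (- t)) * emeasure lborel (cball c t)"
      by (rule nn_integral_cmult_indicator) simp
    also have "\<dots> = ennreal (unit_ball_vol ?n) * (ennreal (t ^ ?n * exp (- t)) * indicator {0..} t)"
    proof (cases "0 \<le> t")
      case True
      then have "emeasure lborel (cball c t) = ennreal (unit_ball_vol ?n * t ^ ?n)"
        by (simp add: emeasure_cball)
      also have "ennreal (exp (- t)) * \<dots> = ennreal (exp (- t) * (unit_ball_vol ?n * t ^ ?n))"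
        by (rule ennreal_mult'[symmetric]) simp
      also have "exp (- t) * (unit_ball_vol ?n * t ^ ?n) = unit_ball_vol ?n * (t ^ ?n * exp (- t))"
        by simp
      also have "ennreal \<dots> = ennreal (unit_ball_vol ?n) * ennreal (t ^ ?n * exp (- t))"
        by (rule ennreal_mult') simp
      finally show ?thesis using True by simp
    qed simp
    finally show "(\<integral>\<^sup>+x. ennreal (exp (- t)) * indicator {q. dist c (fst q) \<le> snd q} (x, t) \<partial>lborel) =
      ennreal (unit_ball_vol ?n) * (ennreal (t ^ ?n * exp (- t)) * indicator {0..} t)" .
  qed
  also have "\<dots> = ennreal (unit_ball_vol ?n) * ennreal (fact ?n)"
    by (subst nn_integral_cmult) (simp_all add: nn_intergal_power_times_exp_Ici)
  also have "\<dots> = ennreal (fact ?n * unit_ball_vol ?n)"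
    by (subst mult.commute) (rule ennreal_mult'[symmetric], simp)
  finally show ?thesis .
qed

lemma pair_sigma_finite_radius: "pair_sigma_finite (radius_measure n) (lborel :: 'a::euclidean_space measure)"
  by (simp add: pair_sigma_finite_def sigma_finite_radius_measure sigma_finite_lborel)

lemma emeasure_ball_radius:
  "emeasure lborel (ball (x :: real ^ 'n) (radius p)) = ennreal (unit_ball_vol CARD('n) * radius p ^ CARD('n))"
  by (simp add: emeasure_ball)

text \<open>The mixture formula at coinciding centres: weighted by ball volume, the radius measure
  is a probability measure.\<close>

lemma nn_integral_ball_volume:
  "(\<integral>\<^sup>+p. ennreal (unit_ball_vol CARD('n) * radius p ^ CARD('n)) \<partial>radius_measure CARD('n::finite)) = 1"
  using nn_integral_ball_Int_ball[of "0 :: real ^ 'n" 0] by (simp add: emeasure_ball_radius)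

text \<open>The mixture formula with centres \<open>x\<close> and 0 is integrated over
  \<open>x\<close>. On the kernel side this is \<open>nn_integral_exp_norm\<close>; on the other
  side the overlap of two r-balls, integrated over one centre, is the square of the ball
  volume.\<close>

lemma nn_integral_ball_volume_squared:
  "(\<integral>\<^sup>+p. ennreal ((unit_ball_vol CARD('n) * radius p ^ CARD('n))\<^sup>2) \<partial>radius_measure CARD('n::finite)) =
    ennreal (fact CARD('n) * unit_ball_vol CARD('n))"
proof -
  interpret pair_sigma_finite "radius_measure CARD('n)" "lborel :: (real ^ 'n) measure"
    by (rule pair_sigma_finite_radius)
  let ?L = "lborel :: (real ^ 'n) measure"
  let ?f = "\<lambda>p x z. indicator {q. dist x z < radius q} p * indicator {q. dist 0 z < radius q} p :: ennreal"
  have "ennreal (fact CARD('n) * unit_ball_vol CARD('n)) = (\<integral>\<^sup>+x. ennreal (exp (- dist 0 x)) \<partial>?L)"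
    by (rule nn_integral_exp_norm[symmetric])
  also have "\<dots> = (\<integral>\<^sup>+x. \<integral>\<^sup>+p. \<integral>\<^sup>+z. ?f p x z \<partial>?L \<partial>radius_measure CARD('n) \<partial>?L)"
  proof (rule nn_integral_cong)
    fix x :: "real ^ 'n"
    have "emeasure lborel (ball x (radius p) \<inter> ball 0 (radius p)) = (\<integral>\<^sup>+z. ?f p x z \<partial>?L)" for p
    proof -
      have "emeasure lborel (ball x (radius p) \<inter> ball 0 (radius p)) = (\<integral>\<^sup>+z. indicator (ball x (radius p) \<inter> ball 0 (radius p)) z \<partial>?L)"
        by (rule nn_integral_indicator[symmetric]) simp
      also have "\<dots> = (\<integral>\<^sup>+z. ?f p x z \<partial>?L)"
        by (intro nn_integral_cong) (simp split: split_indicator)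
      finally show ?thesis .
    qed
    then show "ennreal (exp (- dist 0 x)) = (\<integral>\<^sup>+p. \<integral>\<^sup>+z. ?f p x z \<partial>?L \<partial>radius_measure CARD('n))"
      using nn_integral_ball_Int_ball[of x 0] by (simp only: dist_commute[of 0 x])
  qed
  also have "\<dots> = (\<integral>\<^sup>+p. \<integral>\<^sup>+x. \<integral>\<^sup>+z. ?f p x z \<partial>?L \<partial>?L \<partial>radius_measure CARD('n))"
    by (rule Fubini') measurable
  also have "\<dots> = (\<integral>\<^sup>+p. \<integral>\<^sup>+z. \<integral>\<^sup>+x. ?f p x z \<partial>?L \<partial>?L \<partial>radius_measure CARD('n))"
    by (rule nn_integral_cong, rule lborel_pair.Fubini') measurable
  also have "\<dots> = (\<integral>\<^sup>+p. ennreal ((unit_ball_vol CARD('n) * radius p ^ CARD('n))\<^sup>2) \<partial>radius_measure CARD('n))"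
  proof (rule nn_integral_cong)
    fix p
    have "(\<integral>\<^sup>+z. \<integral>\<^sup>+x. ?f p x z \<partial>?L \<partial>?L) = (\<integral>\<^sup>+z. emeasure ?L (ball z (radius p)) * indicator (ball 0 (radius p)) z \<partial>?L)"
    proof (rule nn_integral_cong)
      fix z :: "real ^ 'n"
      have "(\<integral>\<^sup>+x. ?f p x z \<partial>?L) = (\<integral>\<^sup>+x. indicator (ball 0 (radius p)) z * indicator (ball z (radius p)) x \<partial>?L)"
        by (intro nn_integral_cong) (simp add: dist_commute split: split_indicator)
      also have "\<dots> = indicator (ball 0 (radius p)) z * emeasure ?L (ball z (radius p))"
        by (rule nn_integral_cmult_indicator) simp
      finally show "(\<integral>\<^sup>+x. ?f p x z \<partial>?L) = emeasure ?L (ball z (radius p)) * indicator (ball 0 (radius p)) z"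
        by (simp add: mult.commute)
    qed
    also have "\<dots> = ennreal (unit_ball_vol CARD('n) * radius p ^ CARD('n)) * emeasure ?L (ball 0 (radius p))"
      unfolding emeasure_ball_radius by (subst nn_integral_cmult_indicator) (simp_all add: emeasure_ball_radius)
    finally show "(\<integral>\<^sup>+z. \<integral>\<^sup>+x. ?f p x z \<partial>?L \<partial>?L) = ennreal ((unit_ball_vol CARD('n) * radius p ^ CARD('n))\<^sup>2)"
      by (simp add: emeasure_ball_radius power2_eq_square ennreal_mult')
  qed
  finally show ?thesis ..
qed

lemma magnitude_le_neighbourhood:
  fixes X :: "(real ^ 'n) set" and a :: "real \<times> real \<Rightarrow> real"
  assumes [measurable]: "a \<in> borel_measurable (radius_measure CARD('n))" and nonneg: "\<And>p. 0 \<le> a p"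
    and norm: "(\<integral>\<^sup>+p. ennreal (a p * (unit_ball_vol CARD('n) * radius p ^ CARD('n))) \<partial>radius_measure CARD('n)) = 1"
  shows "magnitude X \<le> enn2ereal (\<integral>\<^sup>+p. ennreal ((a p)\<^sup>2) * emeasure lborel {z. infdist z X < radius p} \<partial>radius_measure CARD('n))"
proof -
  let ?N = "radius_measure CARD('n)" and ?L = "lborel :: (real ^ 'n) measure"
  interpret exp_kernel_representation "?N \<Otimes>\<^sub>M ?L" ball_features
    by (rule exp_kernel_representation_balls)
  define F where "F = (\<lambda>(p, z). a p * indicator {q. infdist z X < radius q} p)"
  have [measurable]: "(\<lambda>z. infdist z X) \<in> borel_measurable ?L"
    by (simp add: borel_measurable_continuous_onI continuous_on_infdist)
  have [measurable]: "F \<in> borel_measurable (?N \<Otimes>\<^sub>M ?L)"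
    unfolding F_def case_prod_unfold by measurable
  have F2: "(\<integral>\<^sup>+q. ennreal ((F q)\<^sup>2) \<partial>(?N \<Otimes>\<^sub>M ?L)) =
     (\<integral>\<^sup>+p. ennreal ((a p)\<^sup>2) * emeasure lborel {z. infdist z X < radius p} \<partial>?N)"
  proof -
    have "(\<integral>\<^sup>+q. ennreal ((F q)\<^sup>2) \<partial>(?N \<Otimes>\<^sub>M ?L)) = (\<integral>\<^sup>+p. \<integral>\<^sup>+z. ennreal ((F (p, z))\<^sup>2) \<partial>?L \<partial>?N)"
      by (rule lborel.nn_integral_fst[symmetric]) measurable
    also have "\<dots> = (\<integral>\<^sup>+p. \<integral>\<^sup>+z. ennreal ((a p)\<^sup>2) * indicator {z. infdist z X < radius p} z \<partial>?L \<partial>?N)"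
      by (intro nn_integral_cong) (simp add: F_def split: split_indicator)
    also have "\<dots> = (\<integral>\<^sup>+p. ennreal ((a p)\<^sup>2) * emeasure lborel {z. infdist z X < radius p} \<partial>?N)"
      by (intro nn_integral_cong nn_integral_cmult_indicator) measurable
    finally show ?thesis .
  qed
  have "ereal (finite_magnitude S) \<le> enn2ereal (\<integral>\<^sup>+q. ennreal ((F q)\<^sup>2) \<partial>(?N \<Otimes>\<^sub>M ?L))"
    if "finite S" "S \<subseteq> X" for S
  proof (rule finite_magnitude_le_nn_integral[OF _ _ _ that])
    show "0 \<le> F q" for q using nonneg by (simp add: F_def case_prod_unfold)
    fix x assume x: "x \<in> X"
    have "(\<integral>\<^sup>+q. ennreal (F q) * indicator (ball_features x) q \<partial>(?N \<Otimes>\<^sub>M ?L)) =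
      (\<integral>\<^sup>+p. \<integral>\<^sup>+z. ennreal (F (p, z)) * indicator (ball_features x) (p, z) \<partial>?L \<partial>?N)"
      by (rule lborel.nn_integral_fst[symmetric]) measurable
    also have "\<dots> = (\<integral>\<^sup>+p. \<integral>\<^sup>+z. ennreal (a p) * indicator (ball x (radius p)) z \<partial>?L \<partial>?N)"
    proof (intro nn_integral_cong)
      fix p z
      \<comment> \<open>Inside a ball about a point of \<open>X\<close> the restriction to the
        neighbourhood is invisible, so the pairing does not depend on \<open>x\<close>.\<close>
      have "infdist z X < radius p" if "dist x z < radius p"
        using infdist_le[OF x, of z] that by (simp add: dist_commute)
      then show "ennreal (F (p, z)) * indicator (ball_features x) (p, z) = ennreal (a p) * indicator (ball x (radius p)) z"
        by (simp add: F_def split: split_indicator)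
    qed
    also have "\<dots> = (\<integral>\<^sup>+p. ennreal (a p) * emeasure ?L (ball x (radius p)) \<partial>?N)"
      by (intro nn_integral_cong nn_integral_cmult_indicator) simp
    also have "\<dots> = 1"
      unfolding emeasure_ball_radius norm[symmetric] using nonneg by (intro nn_integral_cong) (simp add: ennreal_mult')
    finally show "(\<integral>\<^sup>+q. ennreal (F q) * indicator (ball_features x) q \<partial>(?N \<Otimes>\<^sub>M ?L)) = 1" .
  qed measurable
  then show ?thesis
    unfolding magnitude_def F2 by (intro SUP_least) auto
qed

text \<open>With a strict inequality the infimum need not be attained, so no closedness of
  \<open>X\<close> is required.\<close>

lemma infdist_less_iff_ball:
  "X \<noteq> {} \<Longrightarrow> infdist z X < r \<longleftrightarrow> (\<exists>x\<in>X. dist x z < r)"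
  unfolding infdist_def by (simp add: cINF_less_iff dist_commute bdd_belowI2[of _ 0])

lemma emeasure_neighbourhood_le:
  fixes X :: "(real ^ 'n) set"
  assumes "X \<noteq> {}" "X \<subseteq> cball 0 D" "0 \<le> D" "0 \<le> r"
  shows "emeasure lborel {z. infdist z X < r} \<le> ennreal (unit_ball_vol CARD('n) * (D + r) ^ CARD('n))"
proof -
  have "{z. infdist z X < r} \<subseteq> ball 0 (D + r)"
  proof
    fix z assume "z \<in> {z. infdist z X < r}"
    then obtain x where "x \<in> X" "dist x z < r" using infdist_less_iff_ball[OF assms(1)] by auto
    then show "z \<in> ball 0 (D + r)" using assms(2) dist_triangle[of 0 z x] by auto
  qed
  then have "emeasure lborel {z. infdist z X < r} \<le> emeasure lborel (ball 0 (D + r) :: (real ^ 'n) set)"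
    by (rule emeasure_mono) simp
  then show ?thesis using assms by (simp add: emeasure_ball)
qed

section \<open>Bounds for small sets\<close>

lemma magnitude_ge_one:
  fixes X :: "'a::euclidean_space set"
  assumes "X \<noteq> {}"
  shows "1 \<le> magnitude X"
proof -
  obtain x where x: "x \<in> X" using assms by blast
  have "weighting {x} (\<lambda>_. 1)" by (simp add: weighting_def)
  then have "finite_magnitude {x} = 1" by (simp add: finite_magnitude_eq)
  then show ?thesis
    unfolding magnitude_def using x by (intro SUP_upper2[of "{x}"]) (auto simp: one_ereal_def)
qed

text \<open>The weight \<open>a\<close> is constant for radii above \<delta> and 0 below. There the
  neighbourhood exceeds a ball of the same radius by a factor of at most (1 + D / \<delta>)^n, so
  the bound is this factor over \<open>P\<close>, the share of the ball-volume distribution above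
  \<delta>.\<close>

lemma magnitude_le_cutoff:
  fixes X :: "(real ^ 'n) set"
  assumes X: "X \<noteq> {}" "X \<subseteq> cball 0 D" and D: "0 \<le> D" and \<delta>: "0 < \<delta>"
  shows "magnitude X \<le> ereal ((1 + D / \<delta>) ^ CARD('n) * exp (2 * \<delta>))"
proof -
  let ?n = "CARD('n)" let ?N = "radius_measure CARD('n)" and ?L = "lborel :: (real ^ 'n) measure"
  define w where "w p = unit_ball_vol ?n * radius p ^ ?n" for p
  define I where "I p = (indicator {p. \<delta> < radius p} p :: real)" for p
  have w0: "0 \<le> w p" for p by (simp add: w_def)
  have [measurable]: "w \<in> borel_measurable ?N" "I \<in> borel_measurable ?N"
    unfolding w_def[abs_def] I_def[abs_def] by measurable
  have "(\<integral>\<^sup>+p. ennreal (I p * w p) \<partial>?N) \<le> (\<integral>\<^sup>+p. ennreal (w p) \<partial>?N)"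
    using w0 by (intro nn_integral_mono ennreal_leI) (auto simp: I_def split: split_indicator)
  also have "\<dots> = 1" unfolding w_def by (rule nn_integral_ball_volume)
  finally obtain P where P: "(\<integral>\<^sup>+p. ennreal (I p * w p) \<partial>?N) = ennreal P" "0 \<le> P"
    by (cases "(\<integral>\<^sup>+p. ennreal (I p * w p) \<partial>?N)") (auto simp: top_unique)
  obtain k :: 'n where True by blast
  \<comment> \<open>Two r-balls whose centres are 2 \<delta> apart can meet only if r > \<delta>.
    The mixture formula for this pair of centres thus bounds \<open>P\<close> below by exp(-2
    \<delta>).\<close>
  define y :: "real ^ 'n" where "y = (2 * \<delta>) *\<^sub>R axis k 1"
  have y: "dist 0 y = 2 * \<delta>" using \<delta> by (simp add: y_def)
  have "ennreal (exp (- (2 * \<delta>))) = (\<integral>\<^sup>+p. emeasure ?L (ball 0 (radius p) \<inter> ball y (radius p)) \<partial>?N)"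
    unfolding nn_integral_ball_Int_ball y ..
  also have "\<dots> \<le> (\<integral>\<^sup>+p. ennreal (I p * w p) \<partial>?N)"
  proof (rule nn_integral_mono)
    fix p
    show "emeasure ?L (ball 0 (radius p) \<inter> ball y (radius p)) \<le> ennreal (I p * w p)"
    proof (cases "\<delta> < radius p")
      case True
      have "emeasure ?L (ball 0 (radius p) \<inter> ball y (radius p)) \<le> emeasure ?L (ball 0 (radius p))"
        by (rule emeasure_mono) auto
      then show ?thesis using True by (simp add: I_def w_def emeasure_ball_radius)
    next
      case False
      have "ball 0 (radius p) \<inter> ball y (radius p) = {}"
      proof (rule ccontr)
        assume "ball 0 (radius p) \<inter> ball y (radius p) \<noteq> {}"
        then obtain z where "dist 0 z < radius p" "dist y z < radius p" by auto
        with False y dist_triangle2[of 0 y z] show False by auto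
      qed
      then show ?thesis by simp
    qed
  qed
  finally have P1: "exp (- (2 * \<delta>)) \<le> P" using P by simp
  have Ppos: "0 < P" using P1 exp_gt_zero[of "- (2 * \<delta>)"] by linarith
  define a where "a p = I p / P" for p
  have [measurable]: "a \<in> borel_measurable ?N" unfolding a_def[abs_def] by measurable
  have mag: "magnitude X \<le> enn2ereal (\<integral>\<^sup>+p. ennreal ((a p)\<^sup>2) * emeasure lborel {z. infdist z X < radius p} \<partial>?N)"
  proof (rule magnitude_le_neighbourhood)
    have "(\<integral>\<^sup>+p. ennreal (a p * w p) \<partial>?N) = (\<integral>\<^sup>+p. ennreal (1 / P) * ennreal (I p * w p) \<partial>?N)"
      using Ppos w0 by (intro nn_integral_cong) (simp add: a_def ennreal_mult'[symmetric])
    also have "\<dots> = ennreal (1 / P) * ennreal P"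
      by (subst nn_integral_cmult) (simp_all add: P)
    finally show "(\<integral>\<^sup>+p. ennreal (a p * (unit_ball_vol ?n * radius p ^ ?n)) \<partial>?N) = 1"
      using Ppos by (simp add: w_def ennreal_mult'[symmetric])
  qed (use Ppos in \<open>auto simp: a_def I_def\<close>)
  have "(\<integral>\<^sup>+p. ennreal ((a p)\<^sup>2) * emeasure lborel {z. infdist z X < radius p} \<partial>?N) \<le>
    (\<integral>\<^sup>+p. ennreal ((1 + D / \<delta>) ^ ?n / P\<^sup>2) * ennreal (I p * w p) \<partial>?N)"
  proof (rule nn_integral_mono)
    fix p
    show "ennreal ((a p)\<^sup>2) * emeasure lborel {z. infdist z X < radius p} \<le> ennreal ((1 + D / \<delta>) ^ ?n / P\<^sup>2) * ennreal (I p * w p)"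
    proof (cases "\<delta> < radius p")
      case True
      have "D + radius p \<le> (1 + D / \<delta>) * radius p"
      proof -
        have "D = D / \<delta> * \<delta>" using \<delta> by simp
        also have "\<dots> \<le> D / \<delta> * radius p" using True D \<delta> by (intro mult_left_mono) auto
        finally show ?thesis by (simp add: algebra_simps)
      qed
      then have "(D + radius p) ^ ?n \<le> ((1 + D / \<delta>) * radius p) ^ ?n"
        using D by (intro power_mono) auto
      then have "unit_ball_vol ?n * (D + radius p) ^ ?n \<le> (1 + D / \<delta>) ^ ?n * w p"
        using mult_left_mono[of _ _ "unit_ball_vol ?n"] by (fastforce simp: w_def power_mult_distrib mult_ac)
      then have "emeasure lborel {z. infdist z X < radius p} \<le> ennreal ((1 + D / \<delta>) ^ ?n * w p)"
        using emeasure_neighbourhood_le[OF X D radius_nonneg[of p]] by (meson ennreal_leI order_trans)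
      then have "ennreal ((a p)\<^sup>2) * emeasure lborel {z. infdist z X < radius p} \<le> ennreal ((a p)\<^sup>2) * ennreal ((1 + D / \<delta>) ^ ?n * w p)"
        by (rule mult_left_mono) simp
      also have "\<dots> = ennreal ((1 + D / \<delta>) ^ ?n / P\<^sup>2 * (I p * w p))"
        using True by (simp add: ennreal_mult'[symmetric] a_def I_def power_divide)
      also have "\<dots> = ennreal ((1 + D / \<delta>) ^ ?n / P\<^sup>2) * ennreal (I p * w p)"
        using D \<delta> by (intro ennreal_mult') auto
      finally show ?thesis .
    qed (simp add: a_def I_def)
  qed
  also have "(\<integral>\<^sup>+p. ennreal ((1 + D / \<delta>) ^ ?n / P\<^sup>2) * ennreal (I p * w p) \<partial>?N) = ennreal ((1 + D / \<delta>) ^ ?n / P\<^sup>2) * ennreal P"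
    by (subst nn_integral_cmult) (simp_all add: P)
  also have "\<dots> = ennreal ((1 + D / \<delta>) ^ ?n * (1 / P))"
    using Ppos D \<delta> by (simp add: ennreal_mult'[symmetric] power2_eq_square)
  also have "\<dots> \<le> ennreal ((1 + D / \<delta>) ^ ?n * exp (2 * \<delta>))"
  proof (intro ennreal_leI mult_left_mono)
    have "1 / P \<le> 1 / exp (- (2 * \<delta>))" using P1 by (intro divide_left_mono) (auto simp: Ppos)
    then show "1 / P \<le> exp (2 * \<delta>)" by (simp add: exp_minus inverse_eq_divide)
  qed (use D \<delta> in auto)
  finally show ?thesis
    using mag D \<delta> unfolding less_eq_ennreal.rep_eq by (simp add: enn2ereal_ennreal)
qed

section \<open>Volume asymptotics\<close>

text \<open>The kernel integrates to \<kappa> over the whole space, so density 1 / \<kappa> on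
  \<open>X\<close> has potential at most 1 everywhere and its quadratic form is at most its mass V /
  \<kappa>. In \<open>finite_magnitude_ge\<close> this leaves 2 V / \<kappa> - V / \<kappa>. Moving
  the mass to a finite net costs a factor exp \<delta> in the quadratic form.\<close>

lemma magnitude_ge_volume:
  fixes X :: "(real ^ 'n) set"
  assumes X: "compact X"
  shows "ereal (measure lebesgue X / (fact CARD('n) * unit_ball_vol CARD('n))) \<le> magnitude X"
proof -
  let ?L = "lborel :: (real ^ 'n) measure"
  define \<kappa> where "\<kappa> = fact CARD('n) * unit_ball_vol CARD('n)"
  define V where "V = measure lebesgue X"
  have \<kappa>: "0 < \<kappa>" by (simp add: \<kappa>_def)
  have [measurable]: "X \<in> sets borel" using X by (simp add: borel_compact)
  have V: "emeasure ?L X = ennreal V" "0 \<le> V"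
    using emeasure_eq_measure2[OF lmeasurable_compact[OF X]] by (simp_all add: V_def)
  interpret exp_kernel_representation "radius_measure CARD('n) \<Otimes>\<^sub>M ?L" ball_features
    by (rule exp_kernel_representation_balls)
  have approx: "ereal (V / \<kappa> * (2 - exp \<delta>)) \<le> magnitude X" if \<delta>: "0 < \<delta>" for \<delta>
  proof -
    obtain K where K: "finite K" "K \<subseteq> X" "X \<subseteq> (\<Union>x\<in>K. ball x \<delta>)"
      by (rule compactE_image[OF X, of X "\<lambda>x. ball x \<delta>"]) (use \<delta> in auto)
    define h where "h z = (\<Sum>y\<in>K. indicator (ball y \<delta>) z :: real)" for z
    define p where "p y z = indicator X z * (indicator (ball y \<delta>) z / h z)" for y z
    have h0: "0 \<le> h z" for z unfolding h_def by (intro sum_nonneg) simp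
    have p0: "0 \<le> p y z" for y z using h0 by (simp add: p_def)
    have [measurable]: "(indicator (ball y \<delta>) :: _ \<Rightarrow> real) \<in> borel_measurable borel" for y :: "real ^ 'n"
      by (auto intro!: borel_measurable_indicator)
    have [measurable]: "h \<in> borel_measurable borel" unfolding h_def[abs_def] by measurable
    have [measurable]: "p y \<in> borel_measurable borel" for y unfolding p_def[abs_def] by measurable
    \<comment> \<open>\<open>p\<close> is a partition of unity on \<open>X\<close>, which spares us making the cover disjoint\<close>
    have psum: "(\<Sum>y\<in>K. p y z) = indicator X z" for z
    proof (cases "z \<in> X")
      case True
      then obtain y where "y \<in> K" "z \<in> ball y \<delta>" using K by blast
      then have "1 \<le> h z"
        unfolding h_def using member_le_sum[of y K "\<lambda>y. indicator (ball y \<delta>) z :: real"] K(1) by simp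
      then show ?thesis using True
        by (simp add: p_def sum_divide_distrib[symmetric] h_def[symmetric])
    qed (simp add: p_def)
    \<comment> \<open>The share of the volume of \<open>X\<close> that is moved to the centre
      \<open>y\<close>.\<close>
    define u where "u y = enn2real (\<integral>\<^sup>+z. ennreal (p y z) \<partial>?L)" for y
    have u: "(\<integral>\<^sup>+z. ennreal (p y z) \<partial>?L) = ennreal (u y)" if "y \<in> K" for y
    proof -
      have "p y z \<le> indicator X z" for z
        unfolding psum[symmetric] using K(1) that p0 by (intro member_le_sum) auto
      then have "(\<integral>\<^sup>+z. ennreal (p y z) \<partial>?L) \<le> (\<integral>\<^sup>+z. ennreal (indicator X z) \<partial>?L)"
        by (intro nn_integral_mono ennreal_leI)
      also have "\<dots> = ennreal V" by (simp add: ennreal_indicator V)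
      finally have "(\<integral>\<^sup>+z. ennreal (p y z) \<partial>?L) < top" by (rule le_less_trans) simp
      then show ?thesis unfolding u_def by (rule ennreal_enn2real[symmetric])
    qed
    have u0: "0 \<le> u y" for y by (simp add: u_def)
    have "ennreal (\<Sum>y\<in>K. u y) = (\<Sum>y\<in>K. \<integral>\<^sup>+z. ennreal (p y z) \<partial>?L)"
      using u u0 by (subst sum_ennreal[symmetric]) (auto intro!: sum.cong simp del: sum_ennreal)
    also have "\<dots> = (\<integral>\<^sup>+z. ennreal (\<Sum>y\<in>K. p y z) \<partial>?L)"
      using p0 by (subst nn_integral_sum[symmetric]) (simp_all add: sum_ennreal)
    also have "\<dots> = ennreal V" unfolding psum by (simp add: ennreal_indicator V)
    finally have usum: "(\<Sum>y\<in>K. u y) = V"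
      using u0 V by (simp add: sum_nonneg)
    \<comment> \<open>On the support of \<open>p y\<close> the point \<open>z\<close> is within
      \<delta> of \<open>y\<close>, so replacing \<open>y\<close> by \<open>z\<close> in the kernel
      costs at most exp \<delta>; the sum over \<open>K\<close> then becomes an integral over
      \<open>X\<close>, bounded by that over the whole space.\<close>
    have row: "(\<Sum>y\<in>K. u y * exp (- dist x y)) \<le> exp \<delta> * \<kappa>" for x
    proof -
      have "ennreal (\<Sum>y\<in>K. u y * exp (- dist x y)) = (\<Sum>y\<in>K. \<integral>\<^sup>+z. ennreal (p y z * exp (- dist x y)) \<partial>?L)"
      proof (subst sum_ennreal[symmetric])
        show "(\<Sum>y\<in>K. ennreal (u y * exp (- dist x y))) = (\<Sum>y\<in>K. \<integral>\<^sup>+z. ennreal (p y z * exp (- dist x y)) \<partial>?L)"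
        proof (rule sum.cong[OF refl])
          fix y assume "y \<in> K"
          have "(\<integral>\<^sup>+z. ennreal (p y z * exp (- dist x y)) \<partial>?L) = (\<integral>\<^sup>+z. ennreal (p y z) * ennreal (exp (- dist x y)) \<partial>?L)"
            using p0 by (intro nn_integral_cong ennreal_mult') 
          also have "\<dots> = ennreal (u y) * ennreal (exp (- dist x y))"
            by (subst nn_integral_multc) (simp_all add: u[OF \<open>y \<in> K\<close>])
          also have "\<dots> = ennreal (u y * exp (- dist x y))"
            using u0 by (intro ennreal_mult'[symmetric])
          finally show "ennreal (u y * exp (- dist x y)) = (\<integral>\<^sup>+z. ennreal (p y z * exp (- dist x y)) \<partial>?L)" ..
        qed
      qed (use u0 in auto)
      also have "\<dots> = (\<integral>\<^sup>+z. ennreal (\<Sum>y\<in>K. p y z * exp (- dist x y)) \<partial>?L)"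
        using p0 by (subst nn_integral_sum[symmetric]) (simp_all add: sum_ennreal)
      also have "\<dots> \<le> (\<integral>\<^sup>+z. ennreal (exp \<delta>) * ennreal (exp (- dist x z)) \<partial>?L)"
      proof (rule nn_integral_mono)
        fix z
        have "p y z * exp (- dist x y) \<le> p y z * (exp \<delta> * exp (- dist x z))" for y
        proof (cases "z \<in> ball y \<delta>")
          case True
          then have "- dist x y \<le> \<delta> + - dist x z" using dist_triangle[of x z y] by auto
          then have "exp (- dist x y) \<le> exp \<delta> * exp (- dist x z)"
            unfolding exp_add[symmetric] by simp
          then show ?thesis using p0 by (intro mult_left_mono)
        qed (simp add: p_def)
        then have "(\<Sum>y\<in>K. p y z * exp (- dist x y)) \<le> (\<Sum>y\<in>K. p y z * (exp \<delta> * exp (- dist x z)))"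
          by (intro sum_mono)
        also have "\<dots> = indicator X z * (exp \<delta> * exp (- dist x z))"
          unfolding psum[symmetric] by (simp add: sum_distrib_right)
        also have "\<dots> \<le> exp \<delta> * exp (- dist x z)" by (simp split: split_indicator)
        finally show "ennreal (\<Sum>y\<in>K. p y z * exp (- dist x y)) \<le> ennreal (exp \<delta>) * ennreal (exp (- dist x z))"
          by (subst ennreal_mult'[symmetric]) (auto intro!: ennreal_leI)
      qed
      also have "\<dots> = ennreal (exp \<delta> * \<kappa>)"
        unfolding \<kappa>_def by (subst nn_integral_cmult) (simp_all add: nn_integral_exp_norm ennreal_mult'[symmetric])
      finally show ?thesis using \<kappa> by (subst (asm) ennreal_le_iff) auto
    qed
    have "(\<Sum>x\<in>K. \<Sum>y\<in>K. (u x / \<kappa>) * (u y / \<kappa>) * exp (- dist x y)) =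
      (\<Sum>x\<in>K. u x / \<kappa>\<^sup>2 * (\<Sum>y\<in>K. u y * exp (- dist x y)))"
      by (simp add: sum_distrib_left power2_eq_square mult.assoc)
    also have "\<dots> \<le> (\<Sum>x\<in>K. u x / \<kappa>\<^sup>2 * (exp \<delta> * \<kappa>))"
      using u0 row by (intro sum_mono mult_left_mono) auto
    also have "\<dots> = V / \<kappa> * exp \<delta>"
      using \<kappa> unfolding sum_distrib_right[symmetric] sum_divide_distrib[symmetric] usum
      by (simp add: power2_eq_square)
    finally have "V / \<kappa> * (2 - exp \<delta>) \<le> 2 * (\<Sum>x\<in>K. u x / \<kappa>) - (\<Sum>x\<in>K. \<Sum>y\<in>K. (u x / \<kappa>) * (u y / \<kappa>) * exp (- dist x y))"
      unfolding sum_divide_distrib[symmetric] usum by (simp add: algebra_simps)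
    also have "\<dots> \<le> finite_magnitude K" by (rule finite_magnitude_ge[OF K(1)])
    finally show ?thesis
      unfolding magnitude_def using K by (intro SUP_upper2[of K]) auto
  qed
  have "((\<lambda>\<delta>. ereal (V / \<kappa> * (2 - exp \<delta>))) \<longlongrightarrow> ereal (V / \<kappa> * (2 - exp 0))) (at_right 0)"
    by (intro tendsto_intros)
  moreover have "\<forall>\<^sub>F \<delta> in at_right 0. ereal (V / \<kappa> * (2 - exp \<delta>)) \<le> magnitude X"
    using approx by (auto simp: eventually_at_right_field intro!: exI[of _ 1])
  ultimately have "ereal (V / \<kappa> * (2 - exp 0)) \<le> magnitude X"
    by (intro tendsto_upperbound) auto
  then show ?thesis by (simp add: V_def \<kappa>_def)
qed

section \<open>Behaviour under dilation, and the limits\<close>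

lemma compact_subset_cball_0:
  fixes X :: "'a::real_normed_vector set"
  assumes "compact X"
  obtains D where "X \<subseteq> cball 0 D" "0 \<le> D"
proof -
  obtain b where "0 < b" "\<forall>x\<in>X. norm x \<le> b"
    using compact_imp_bounded[OF assms] unfolding bounded_pos by blast
  then show thesis by (intro that[of b]) auto
qed

lemma neighbourhood_scaleR:
  fixes X :: "'a::real_normed_vector set"
  assumes "X \<noteq> {}" "0 < R"
  shows "{z. infdist z ((\<lambda>x. R *\<^sub>R x) ` X) < r} = (\<lambda>z. R *\<^sub>R z) ` {z. infdist z X < r / R}"
proof -
  have d: "dist (R *\<^sub>R x) (R *\<^sub>R z) < r \<longleftrightarrow> dist x z < r / R" for x z :: 'a
  proof -
    have "dist (R *\<^sub>R x) (R *\<^sub>R z) = R * dist x z"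
      using assms(2) by (simp add: dist_norm scaleR_diff_right[symmetric])
    then show ?thesis using assms(2) by (simp add: field_simps)
  qed
  have "infdist (R *\<^sub>R z) ((\<lambda>x. R *\<^sub>R x) ` X) < r \<longleftrightarrow> infdist z X < r / R" for z
    using assms(1) by (simp add: infdist_less_iff_ball d)
  note eq = this
  show ?thesis
  proof (intro set_eqI iffI)
    fix z assume z: "z \<in> {z. infdist z ((\<lambda>x. R *\<^sub>R x) ` X) < r}"
    have "z = R *\<^sub>R ((1 / R) *\<^sub>R z)" using assms(2) by simp
    then show "z \<in> (\<lambda>z. R *\<^sub>R z) ` {z. infdist z X < r / R}"
      using z eq[of "(1 / R) *\<^sub>R z"] by (intro image_eqI) auto
  qed (use eq in auto)
qed

lemma measure_lebesgue_scaleR: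
  fixes S :: "'a::euclidean_space set"
  assumes "0 < R"
  shows "measure lebesgue ((\<lambda>x. R *\<^sub>R x) ` S) = R ^ DIM('a) * measure lebesgue S"
  using measure_lebesgue_affine[of R 0 S] assms by simp

lemma emeasure_lborel_scaleR:
  fixes S :: "'a::euclidean_space set"
  assumes "0 < R" "open S"
  shows "emeasure lborel ((\<lambda>x. R *\<^sub>R x) ` S) = ennreal (R ^ DIM('a)) * emeasure lborel S"
proof -
  have "open ((\<lambda>x. R *\<^sub>R x) ` S)" using assms by (intro open_scaling) auto
  then show ?thesis
    using emeasure_lebesgue_affine[of R 0 S] assms by (simp add: ennreal_power)
qed

lemma open_neighbourhood: "open {z. infdist z X < r}"
  by (intro open_Collect_less continuous_intros)

text \<open>Since \<open>X\<close> is closed, a point outside it has positive distance and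
  eventually leaves the neighbourhoods. The sequence \<open>e\<close> need not be monotone, so
  dominated convergence takes the place of continuity from above.\<close>

lemma LIMSEQ_emeasure_neighbourhood:
  fixes X :: "(real ^ 'n) set"
  assumes X: "compact X" "X \<noteq> {}" and e: "\<And>k. 0 < e k" "e \<longlonglongrightarrow> 0"
  shows "(\<lambda>k. emeasure lborel {z. infdist z X < e k}) \<longlonglongrightarrow> emeasure lborel X"
proof -
  obtain D where D: "X \<subseteq> cball 0 D" "0 \<le> D"
    using compact_subset_cball_0[OF X(1)] .
  obtain B where B: "\<And>k. e k \<le> B" 
    using convergent_imp_Bseq[OF convergentI[OF e(2)]] unfolding Bseq_def by (metis abs_le_D1 real_norm_def)
  have B0: "0 \<le> B" using e(1)[of 0] B[of 0] by simp
  have [measurable]: "X \<in> sets borel" using X(1) by (simp add: borel_compact)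
  have [measurable]: "{z. infdist z X < r} \<in> sets borel" for r
    by (rule borel_open[OF open_neighbourhood])
  have "(\<lambda>k. \<integral>\<^sup>+z. indicator {z. infdist z X < e k} z \<partial>lborel) \<longlonglongrightarrow> (\<integral>\<^sup>+z. indicator X z \<partial>lborel)"
  proof (rule nn_integral_dominated_convergence[where w="indicator {z. infdist z X < B + 1}"])
    show "(\<integral>\<^sup>+z. indicator {z. infdist z X < B + 1} z \<partial>lborel) < \<infinity>"
      using emeasure_neighbourhood_le[OF X(2) D, of "B + 1"] B0
      by (simp add: le_less_trans)
    show "AE z in lborel. indicator {z. infdist z X < e j} z \<le> (indicator {z. infdist z X < B + 1} z :: ennreal)" for j
      using B[of j] by (intro AE_I2) (auto split: split_indicator)
    show "AE z in lborel. (\<lambda>k. indicator {z. infdist z X < e k} z :: ennreal) \<longlonglongrightarrow> indicator X z"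
    proof (intro AE_I2 tendsto_eventually)
      fix z
      show "\<forall>\<^sub>F k in sequentially. indicator {z. infdist z X < e k} z = (indicator X z :: ennreal)"
      proof (cases "z \<in> X")
        case True
        then show ?thesis using e(1) by (simp add: infdist_zero)
      next
        case False
        then have "0 < infdist z X"
          using X by (intro infdist_pos_not_in_closed compact_imp_closed)
        then have "\<forall>\<^sub>F k in sequentially. e k < infdist z X"
          using e(2) by (rule order_tendstoD(2)[rotated])
        then show ?thesis by eventually_elim (use False in auto)
      qed
    qed
  qed measurable
  then show ?thesis by simp
qed

lemma measurable_emeasure_neighbourhood [measurable]:
  fixes X :: "(real ^ 'n) set"
  shows "(\<lambda>p. emeasure lborel {z. infdist z X < radius p / R}) \<in> borel_measurable (radius_measure n)"
proof -
  have [measurable]: "(\<lambda>z. infdist z X) \<in> borel_measurable lborel"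
    by (simp add: borel_measurable_continuous_onI continuous_on_infdist)
  have [measurable]: "{z. infdist z X < r} \<in> sets borel" for r
    by (rule borel_open[OF open_neighbourhood])
  have "(\<lambda>p. emeasure lborel {z. infdist z X < radius p / R}) = (\<lambda>p. \<integral>\<^sup>+z. indicator {q. infdist z X < radius q / R} p \<partial>lborel)"
    by (auto simp: fun_eq_iff nn_integral_indicator[symmetric] simp del: nn_integral_indicator intro!: nn_integral_cong split: split_indicator)
  also have "\<dots> \<in> borel_measurable (radius_measure n)" by measurable
  finally show ?thesis .
qed

text \<open>The r-neighbourhood of \<open>R X\<close> is \<open>R\<close> times the (r /
  R)-neighbourhood of \<open>X\<close>. Its volume therefore carries the factor R^n that the
  normalisation removes, and \<open>R\<close> survives only in the radius of the
  neighbourhood.\<close>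

lemma magnitude_scaleR_le:
  fixes X :: "(real ^ 'n) set"
  assumes X: "X \<noteq> {}" and R: "0 < R"
  shows "ereal (1 / R ^ CARD('n)) * magnitude ((\<lambda>x. R *\<^sub>R x) ` X) \<le>
    enn2ereal (\<integral>\<^sup>+p. ennreal ((radius p ^ CARD('n) / fact CARD('n))\<^sup>2) * emeasure lborel {z. infdist z X < radius p / R}
      \<partial>radius_measure CARD('n))"
proof -
  let ?n = "CARD('n)" let ?N = "radius_measure CARD('n)"
  define a where "a p = radius p ^ ?n / fact ?n" for p
  have a0: "0 \<le> a p" for p by (simp add: a_def)
  have [measurable]: "a \<in> borel_measurable ?N" unfolding a_def[abs_def] by measurable
  define \<omega> where "\<omega> = unit_ball_vol ?n"
  have \<omega>: "0 < \<omega>" by (simp add: \<omega>_def)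
  have "magnitude ((\<lambda>x. R *\<^sub>R x) ` X) \<le> enn2ereal (\<integral>\<^sup>+p. ennreal ((a p)\<^sup>2) *
    emeasure lborel {z. infdist z ((\<lambda>x. R *\<^sub>R x) ` X) < radius p} \<partial>?N)"
  proof (rule magnitude_le_neighbourhood[OF _ a0])
    \<comment> \<open>Up to the factor \<omega> n! the integrand is the squared ball volume; the
      denominator n! in \<open>a\<close> is what makes the integral 1.\<close>
    have "(\<integral>\<^sup>+p. ennreal (a p * (\<omega> * radius p ^ ?n)) \<partial>?N) =
      (\<integral>\<^sup>+p. ennreal (1 / (\<omega> * fact ?n)) * ennreal ((\<omega> * radius p ^ ?n)\<^sup>2) \<partial>?N)"
      using \<omega> by (intro nn_integral_cong) (simp add: a_def ennreal_mult'[symmetric] power2_eq_square)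
    also have "\<dots> = ennreal (1 / (\<omega> * fact ?n)) * ennreal (fact ?n * \<omega>)"
      unfolding \<omega>_def by (subst nn_integral_cmult) (simp_all add: nn_integral_ball_volume_squared)
    also have "\<dots> = 1" using \<omega> by (simp add: ennreal_mult'[symmetric])
    finally show "(\<integral>\<^sup>+p. ennreal (a p * (unit_ball_vol ?n * radius p ^ ?n)) \<partial>?N) = 1"
      by (simp add: \<omega>_def)
  qed measurable
  also have "(\<integral>\<^sup>+p. ennreal ((a p)\<^sup>2) * emeasure lborel {z. infdist z ((\<lambda>x. R *\<^sub>R x) ` X) < radius p} \<partial>?N) =
     (\<integral>\<^sup>+p. ennreal (R ^ ?n) * (ennreal ((a p)\<^sup>2) * emeasure lborel {z. infdist z X < radius p / R}) \<partial>?N)"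
    unfolding neighbourhood_scaleR[OF X R] emeasure_lborel_scaleR[OF R open_neighbourhood] by (simp add: mult_ac)
  also have "\<dots> = ennreal (R ^ ?n) * (\<integral>\<^sup>+p. ennreal ((a p)\<^sup>2) * emeasure lborel {z. infdist z X < radius p / R} \<partial>?N)"
    by (rule nn_integral_cmult) measurable
  finally have "ereal (1 / R ^ ?n) * magnitude ((\<lambda>x. R *\<^sub>R x) ` X) \<le>
    ereal (1 / R ^ ?n) * enn2ereal (ennreal (R ^ ?n) * (\<integral>\<^sup>+p. ennreal ((a p)\<^sup>2) * emeasure lborel {z. infdist z X < radius p / R} \<partial>?N))"
    using R by (intro ereal_mult_left_mono) auto
  also have "\<dots> = enn2ereal (\<integral>\<^sup>+p. ennreal ((a p)\<^sup>2) * emeasure lborel {z. infdist z X < radius p / R} \<partial>?N)"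
    using R by (simp add: times_ennreal.rep_eq enn2ereal_ennreal mult.assoc[symmetric] one_ereal_def[symmetric])
  finally show ?thesis by (simp add: a_def)
qed

lemma tendsto_neighbourhood_integral:
  fixes X :: "(real ^ 'n) set"
  assumes X: "compact X" "X \<noteq> {}"
  shows "((\<lambda>R. \<integral>\<^sup>+p. ennreal ((radius p ^ CARD('n) / fact CARD('n))\<^sup>2) * emeasure lborel {z. infdist z X < radius p / R}
      \<partial>radius_measure CARD('n)) \<longlongrightarrow> ennreal (measure lebesgue X / (fact CARD('n) * unit_ball_vol CARD('n)))) at_top"
proof (rule tendsto_at_topI_sequentially)
  let ?n = "CARD('n)" let ?N = "radius_measure CARD('n)"
  define a where "a p = radius p ^ ?n / fact ?n" for p
  have [measurable]: "a \<in> borel_measurable ?N" unfolding a_def[abs_def] by measurable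
  define \<omega> where "\<omega> = unit_ball_vol ?n"
  have \<omega>: "0 < \<omega>" by (simp add: \<omega>_def)
  define V where "V = measure lebesgue X"
  have [measurable]: "X \<in> sets borel" using X by (simp add: borel_compact)
  have V: "emeasure lborel X = ennreal V" "0 \<le> V"
    using emeasure_eq_measure2[OF lmeasurable_compact[OF X(1)]] by (simp_all add: V_def)
  obtain D where D: "X \<subseteq> cball 0 D" "0 \<le> D"
    using compact_subset_cball_0[OF X(1)] .
  fix Y :: "nat \<Rightarrow> real" assume Y: "filterlim Y at_top sequentially"
  \<comment> \<open>Truncation at 1 makes domination possible: the neighbourhoods of radius
    \<open>radius p / Z k\<close> all lie in that of radius \<open>radius p\<close>. Eventually
    \<open>Z\<close> and \<open>Y\<close> agree.\<close>
  define Z where "Z k = max 1 (Y k)" for k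
  have Z1: "1 \<le> Z k" for k by (simp add: Z_def)
  have Z: "filterlim Z at_top sequentially"
    by (rule filterlim_at_top_mono[OF Y]) (simp add: Z_def)
  have lim: "(\<lambda>k. \<integral>\<^sup>+p. ennreal ((a p)\<^sup>2) * emeasure lborel {z. infdist z X < radius p / Z k} \<partial>?N) \<longlonglongrightarrow>
    (\<integral>\<^sup>+p. ennreal ((a p)\<^sup>2) * emeasure lborel X \<partial>?N)"
  proof (rule nn_integral_dominated_convergence)
    \<comment> \<open>A neighbourhood has volume at most \<omega> (D + r)^n, and (D + r)^n is at
      most 2^n (D^n + r^n). Multiplying by the square of \<open>a\<close> leaves the moments of
      orders 2 n and 3 n, both finite.\<close>
    let ?w = "\<lambda>p. ennreal (2 ^ ?n * \<omega> / (fact ?n)\<^sup>2) * (ennreal (D ^ ?n) * ennreal (radius p ^ (2 * ?n)) + ennreal (radius p ^ (3 * ?n)))"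
    show "?w \<in> borel_measurable ?N" by measurable
    have "(\<integral>\<^sup>+p. ?w p \<partial>?N) = ennreal (2 ^ ?n * \<omega> / (fact ?n)\<^sup>2) *
       (ennreal (D ^ ?n) * (\<integral>\<^sup>+p. ennreal (radius p ^ (2 * ?n)) \<partial>?N) + (\<integral>\<^sup>+p. ennreal (radius p ^ (3 * ?n)) \<partial>?N))"
      by (simp add: nn_integral_cmult nn_integral_add)
    also have "\<dots> < \<infinity>"
      using nn_integral_radius_power_finite[of ?n "2 * ?n"] nn_integral_radius_power_finite[of ?n "3 * ?n"]
      by (simp add: ennreal_mult_less_top)
    finally show "(\<integral>\<^sup>+p. ?w p \<partial>?N) < \<infinity>" .
    show "AE p in ?N. ennreal ((a p)\<^sup>2) * emeasure lborel {z. infdist z X < radius p / Z j} \<le> ?w p" for j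
    proof (rule AE_I2)
      fix p
      have "radius p / Z j \<le> radius p / 1" using Z1[of j] by (intro divide_left_mono) auto
      then have "{z. infdist z X < radius p / Z j} \<subseteq> {z. infdist z X < radius p}" by auto
      then have "emeasure lborel {z. infdist z X < radius p / Z j} \<le> emeasure lborel {z. infdist z X < radius p}"
        by (rule emeasure_mono) (simp add: borel_open[OF open_neighbourhood])
      also have "\<dots> \<le> ennreal (\<omega> * (D + radius p) ^ ?n)"
        unfolding \<omega>_def by (rule emeasure_neighbourhood_le[OF X(2) D radius_nonneg])
      also have "\<dots> \<le> ennreal (\<omega> * (2 ^ ?n * (D ^ ?n + radius p ^ ?n)))"
      proof (intro ennreal_leI mult_left_mono)
        have "(D + radius p) ^ ?n \<le> (2 * max D (radius p)) ^ ?n"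
          using D by (intro power_mono) auto
        also have "\<dots> = 2 ^ ?n * max (D ^ ?n) (radius p ^ ?n)"
          using D by (auto simp: power_mult_distrib max_def intro: power_mono antisym)
        also have "\<dots> \<le> 2 ^ ?n * (D ^ ?n + radius p ^ ?n)"
          using D by (intro mult_left_mono) auto
        finally show "(D + radius p) ^ ?n \<le> 2 ^ ?n * (D ^ ?n + radius p ^ ?n)" .
      qed (use \<omega> in auto)
      finally have "ennreal ((a p)\<^sup>2) * emeasure lborel {z. infdist z X < radius p / Z j} \<le>
          ennreal ((a p)\<^sup>2) * ennreal (\<omega> * (2 ^ ?n * (D ^ ?n + radius p ^ ?n)))"
        by (rule mult_left_mono) simp
      also have "\<dots> = ennreal ((a p)\<^sup>2 * (\<omega> * (2 ^ ?n * (D ^ ?n + radius p ^ ?n))))"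
        by (rule ennreal_mult'[symmetric]) simp
      also have "(a p)\<^sup>2 * (\<omega> * (2 ^ ?n * (D ^ ?n + radius p ^ ?n))) =
        2 ^ ?n * \<omega> / (fact ?n)\<^sup>2 * (D ^ ?n * radius p ^ (2 * ?n) + radius p ^ (3 * ?n))"
      proof -
        have "radius p ^ (2 * ?n) = (radius p ^ ?n)\<^sup>2" "radius p ^ (3 * ?n) = (radius p ^ ?n)\<^sup>2 * radius p ^ ?n"
          by (simp_all add: power_mult[symmetric] power_add[symmetric] mult.commute)
        then show ?thesis by (simp add: a_def power_divide algebra_simps)
      qed
      also have "ennreal \<dots> = ?w p"
      proof (subst ennreal_mult')
        show "0 \<le> 2 ^ ?n * \<omega> / (fact ?n)\<^sup>2" using \<omega> by simp
        have "ennreal (D ^ ?n * radius p ^ (2 * ?n) + radius p ^ (3 * ?n)) =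
          ennreal (D ^ ?n * radius p ^ (2 * ?n)) + ennreal (radius p ^ (3 * ?n))"
          using D by (intro ennreal_plus) auto
        also have "ennreal (D ^ ?n * radius p ^ (2 * ?n)) = ennreal (D ^ ?n) * ennreal (radius p ^ (2 * ?n))"
          using D by (intro ennreal_mult') auto
        finally show "ennreal (2 ^ ?n * \<omega> / (fact ?n)\<^sup>2) * ennreal (D ^ ?n * radius p ^ (2 * ?n) + radius p ^ (3 * ?n)) = ?w p"
          by (rule arg_cong)
      qed
      finally show "ennreal ((a p)\<^sup>2) * emeasure lborel {z. infdist z X < radius p / Z j} \<le> ?w p" .
    qed
    show "AE p in ?N. (\<lambda>k. ennreal ((a p)\<^sup>2) * emeasure lborel {z. infdist z X < radius p / Z k}) \<longlonglongrightarrow>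
       ennreal ((a p)\<^sup>2) * emeasure lborel X"
    proof (rule AE_I2)
      fix p
      show "(\<lambda>k. ennreal ((a p)\<^sup>2) * emeasure lborel {z. infdist z X < radius p / Z k}) \<longlonglongrightarrow>
       ennreal ((a p)\<^sup>2) * emeasure lborel X"
      \<comment> \<open>At radius 0 the neighbourhoods are empty and need not approximate
        \<open>X\<close>, but \<open>a p\<close> vanishes there because the dimension is
        positive.\<close>
      proof (cases "radius p = 0")
        case False
        then have "0 < radius p" using radius_nonneg[of p] by linarith
        moreover have "(\<lambda>k. radius p / Z k) \<longlonglongrightarrow> 0"
          by (rule tendsto_divide_0[OF tendsto_const filterlim_at_top_imp_at_infinity[OF Z]])
        moreover have "0 < Z k" for k using Z1[of k] by linarith
        ultimately show ?thesis
          by (intro tendsto_mult_ennreal tendsto_const LIMSEQ_emeasure_neighbourhood[OF X])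
             (auto simp: V)
      qed (simp add: a_def power_0_left)
    qed
  qed measurable
  \<comment> \<open>The square of \<open>a\<close> is that of the ball volume divided by (\<omega>
    n!)^2, and the latter integrates to \<omega> n!; one factor \<omega> n! remains in the
    denominator.\<close>
  have "(\<integral>\<^sup>+p. ennreal ((a p)\<^sup>2) * emeasure lborel X \<partial>?N) =
     (\<integral>\<^sup>+p. ennreal (V / (\<omega>\<^sup>2 * (fact ?n)\<^sup>2)) * ennreal ((\<omega> * radius p ^ ?n)\<^sup>2) \<partial>?N)"
    using \<omega> V(2) unfolding V(1)
    by (intro nn_integral_cong) (simp add: ennreal_mult'[symmetric] a_def power_mult_distrib power_divide)
  also have "\<dots> = ennreal (V / (\<omega>\<^sup>2 * (fact ?n)\<^sup>2)) * ennreal (fact ?n * \<omega>)"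
    unfolding \<omega>_def by (subst nn_integral_cmult) (simp_all add: nn_integral_ball_volume_squared)
  also have "\<dots> = ennreal (V / (fact ?n * \<omega>))"
    using \<omega> V(2) by (simp add: ennreal_mult'[symmetric] power2_eq_square)
  finally have val: "(\<integral>\<^sup>+p. ennreal ((a p)\<^sup>2) * emeasure lborel X \<partial>?N) = ennreal (V / (fact ?n * \<omega>))" .
  have "\<forall>\<^sub>F k in sequentially. Z k = Y k"
    using filterlim_at_top[THEN iffD1, OF Y, rule_format, of 1] by eventually_elim (simp add: Z_def)
  then have "\<forall>\<^sub>F k in sequentially. (\<integral>\<^sup>+p. ennreal ((a p)\<^sup>2) * emeasure lborel {z. infdist z X < radius p / Z k} \<partial>?N) =
     (\<integral>\<^sup>+p. ennreal ((a p)\<^sup>2) * emeasure lborel {z. infdist z X < radius p / Y k} \<partial>?N)"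
    by eventually_elim simp
  from Lim_transform_eventually[OF lim[unfolded val] this]
  show "(\<lambda>k. \<integral>\<^sup>+p. ennreal ((radius p ^ ?n / fact ?n)\<^sup>2) * emeasure lborel {z. infdist z X < radius p / Y k} \<partial>?N)
    \<longlonglongrightarrow> ennreal (measure lebesgue X / (fact ?n * unit_ball_vol ?n))"
    by (simp add: a_def V_def \<omega>_def)
qed

theorem theorem1:
  fixes X :: "(real ^ 'n) set"
  assumes "compact X" and "X \<noteq> {}"
  shows "((\<lambda>R::real. magnitude ((\<lambda>x. R *\<^sub>R x) ` X)) \<longlongrightarrow> 1) (at_right 0) \<and>
    ((\<lambda>R::real. ereal (R powi (- int CARD('n))) * magnitude ((\<lambda>x. R *\<^sub>R x) ` X)) \<longlongrightarrow>
      ereal (measure lebesgue X / (fact CARD('n) * measure lebesgue (ball (0 :: real ^ 'n) 1)))) at_top"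
proof
  let ?n = "CARD('n)"
  obtain D where D: "X \<subseteq> cball 0 D" "0 \<le> D"
    using compact_subset_cball_0[OF assms(1)] .
  show "((\<lambda>R::real. magnitude ((\<lambda>x. R *\<^sub>R x) ` X)) \<longlongrightarrow> 1) (at_right 0)"
  proof (rule tendsto_sandwich)
    show "\<forall>\<^sub>F R in at_right 0. 1 \<le> magnitude ((\<lambda>x. R *\<^sub>R x) ` X)"
      using assms by (intro always_eventually allI magnitude_ge_one) auto
    \<comment> \<open>The cut-off is \<delta> = sqrt R: it tends to 0, and so does its ratio with
      the size \<open>R * D\<close> of the dilated set.\<close>
    show "\<forall>\<^sub>F R in at_right 0. magnitude ((\<lambda>x. R *\<^sub>R x) ` X) \<le> ereal ((1 + D * sqrt R) ^ ?n * exp (2 * sqrt R))"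
      using eventually_at_right_less[of "0::real"]
    proof eventually_elim
      case (elim R)
      have "(\<lambda>x. R *\<^sub>R x) ` X \<subseteq> cball 0 (R * D)"
        using D elim by (auto intro!: mult_left_mono)
      then have "magnitude ((\<lambda>x. R *\<^sub>R x) ` X) \<le> ereal ((1 + R * D / sqrt R) ^ ?n * exp (2 * sqrt R))"
        using assms D elim by (intro magnitude_le_cutoff) auto
      also have "R * D / sqrt R = D * sqrt R"
        using elim by (simp add: field_simps)
      finally show ?case .
    qed
    have "((\<lambda>R. ereal ((1 + D * sqrt R) ^ ?n * exp (2 * sqrt R))) \<longlongrightarrow> ereal ((1 + D * sqrt 0) ^ ?n * exp (2 * sqrt 0))) (at_right 0)"
      by (intro tendsto_intros)
    then show "((\<lambda>R. ereal ((1 + D * sqrt R) ^ ?n * exp (2 * sqrt R))) \<longlongrightarrow> 1) (at_right 0)"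
      by (simp add: one_ereal_def)
  qed (rule tendsto_const)
  let ?c = "measure lebesgue X / (fact ?n * unit_ball_vol ?n)"
  let ?G = "\<lambda>R. \<integral>\<^sup>+p. ennreal ((radius p ^ ?n / fact ?n)\<^sup>2) * emeasure lborel {z. infdist z X < radius p / R}
      \<partial>radius_measure ?n"
  have "((\<lambda>R::real. ereal (R powi (- int ?n)) * magnitude ((\<lambda>x. R *\<^sub>R x) ` X)) \<longlongrightarrow> ereal ?c) at_top"
  proof (rule tendsto_sandwich)
    \<comment> \<open>The volume bound applied to the dilated set scales exactly by R^n, so this
      lower bound holds for every positive \<open>R\<close> and not only in the limit.\<close>
    show "\<forall>\<^sub>F R in at_top. ereal ?c \<le> ereal (R powi (- int ?n)) * magnitude ((\<lambda>x. R *\<^sub>R x) ` X)"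
      using eventually_gt_at_top[of "0::real"]
    proof eventually_elim
      case (elim R)
      have "ereal (1 / R ^ ?n) * ereal (measure lebesgue ((\<lambda>x. R *\<^sub>R x) ` X) / (fact ?n * unit_ball_vol ?n))
        \<le> ereal (1 / R ^ ?n) * magnitude ((\<lambda>x. R *\<^sub>R x) ` X)"
        using elim assms by (intro ereal_mult_left_mono magnitude_ge_volume compact_scaling) auto
      with elim show ?case
        by (simp add: measure_lebesgue_scaleR power_int_minus field_simps)
    qed
    show "\<forall>\<^sub>F R in at_top. ereal (R powi (- int ?n)) * magnitude ((\<lambda>x. R *\<^sub>R x) ` X) \<le> enn2ereal (?G R)"
      using eventually_gt_at_top[of "0::real"]
    proof eventually_elim
      case (elim R)
      then show ?case using magnitude_scaleR_le[OF assms(2) elim]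
        by (simp add: power_int_minus inverse_eq_divide)
    qed
    have "((\<lambda>R. enn2ereal (?G R)) \<longlongrightarrow> enn2ereal (ennreal ?c)) at_top"
      using tendsto_neighbourhood_integral[OF assms] by (intro continuous_on_tendsto_compose[OF continuous_on_enn2ereal]) auto
    then show "((\<lambda>R. enn2ereal (?G R)) \<longlongrightarrow> ereal ?c) at_top"
      by (simp add: enn2ereal_ennreal)
  qed (rule tendsto_const)
  moreover have "measure lebesgue (ball (0 :: real ^ 'n) 1) = unit_ball_vol ?n"
    by (simp add: content_ball)
  ultimately show "((\<lambda>R::real. ereal (R powi (- int ?n)) * magnitude ((\<lambda>x. R *\<^sub>R x) ` X)) \<longlongrightarrow>
      ereal (measure lebesgue X / (fact ?n * measure lebesgue (ball (0 :: real ^ 'n) 1)))) at_top"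
    by simp
qed

end
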